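(* The following are true. (i) There exists an explicit constant $c>0$ such that for all sufficiently large $X$, $$E_{\mathrm{ce}}(0,4;X)>c\sqrt{X}.$$ (ii) There exist an explicit constant $c>0$ and a real number $\alpha$ with $0<\alpha<1$ such that for all sufficiently large $X$, $$E_{\mathrm{co}_1'}(0,4;X)>\frac{X\log^{\alpha}X-cX}{(\sqrt{24X+1}+1)\log^{\alpha}X}.$$ (iii) There exists an explicit constant $c>0$ such that for all sufficiently large $X$, $$E_{\mathrm{co}_2}(0,2;X)>c\sqrt{X}.$$
   Context: All parts $a_i,b_i$ below are non-negative integers, and compositions are ordered. For an integer $n\ge 0$: - $\mathrm{ce}(n)$ is the number of concave compositions of even length of $n$, i.e. ordered representations $n=a_1+a_2+\cdots+a_m+b_1+b_2+\cdots+b_m$ (with $m\ge 1$) such that $a_1>a_2>\cdots>a_m=b_m<b_{m-1}<\cdots<b_1$ and $a_m\ge 0$. (The first values are $\mathrm{ce}(0),\mathrm{ce}(1),\dots = 1,0,2,2,4,4,\dots$.) - $\mathrm{co}_1(n)$ is the number of concave compositions of odd length of type 1 of $n$, i.e. ordered representations $n=a_1+\cdots+a_{m+1}+b_1+\cdots+b_m$ (with $m\ge 0$) such that $a_1>a_2>\cdots>a_{m+1}<b_m<b_{m-1}<\cdots<b_1$ and $a_{m+1}\ge 0$. (First values: $1,1,2,3,4,6,\dots$.) - $\mathrm{co}_2(n)$ is the number of concave compositions of odd length of type 2 of $n$, i.e. ordered representations $n=a_1+\cdots+a_{m+1}+b_1+\cdots+b_m$ (with $m\ge 0$) such that $a_1>a_2>\cdots>a_{m+1}\le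 b_m<b_{m-1}<\cdots<b_1$ and $a_{m+1}\ge 0$. (First values: $1,2,3,4,7,10,\dots$.) - $\mathrm{co}_1'(n)=\mathrm{co}_1(n)-1$ if $n$ is a triangular number (i.e. $n=k(k+1)/2$ for some integer $k\ge 0$), and $\mathrm{co}_1'(n)=\mathrm{co}_1(n)$ otherwise. For a function $f$ from the non-negative integers to the integers, and integers $r$ and $a\ge 1$, define $E_f(r,a;X)=\#\{n<X: f(n)\equiv r \pmod a\}$, where $n$ ranges over non-negative integers. Here $\log^{\alpha}X$ means $(\log X)^{\alpha}$. The constants $c$ in the three parts need not be equal. *)

theory Defs
  imports Complex_Main "HOL-Number_Theory.Cong"
begin

text \<open>
  A concave composition is encoded as a pair of lists \<open>(as, bs)\<close> with
  \<open>as = [a\<^sub>1, a\<^sub>2, \<dots>]\<close> and \<open>bs = [b\<^sub>1, b\<^sub>2, \<dots>]\<close>, both listed from the outside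
  inwards. Hence both lists are strictly decreasing, and the innermost parts are
  \<open>last as\<close> and \<open>last bs\<close>. Parts may be zero.
\<close>

definition concave_even :: "nat \<Rightarrow> (nat list \<times> nat list) set" where
  "concave_even n = {(as, bs).
     length as = length bs \<and> length as \<ge> 1 \<and>
     sorted_wrt (>) as \<and> sorted_wrt (>) bs \<and> last as = last bs \<and>
     sum_list as + sum_list bs = n}"

text \<open>In the odd cases \<open>bs\<close> may be empty; the condition linking the two sides is then void.\<close>

definition concave_odd1 :: "nat \<Rightarrow> (nat list \<times> nat list) set" where
  "concave_odd1 n = {(as, bs).
     length as = length bs + 1 \<and>
     sorted_wrt (>) as \<and> sorted_wrt (>) bs \<and> (bs \<noteq> [] \<longrightarrow> last as < last bs) \<and>
     sum_list as + sum_list bs = n}"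

definition concave_odd2 :: "nat \<Rightarrow> (nat list \<times> nat list) set" where
  "concave_odd2 n = {(as, bs).
     length as = length bs + 1 \<and>
     sorted_wrt (>) as \<and> sorted_wrt (>) bs \<and> (bs \<noteq> [] \<longrightarrow> last as \<le> last bs) \<and>
     sum_list as + sum_list bs = n}"

definition ce :: "nat \<Rightarrow> nat" where
  "ce n = card (concave_even n)"

definition co1 :: "nat \<Rightarrow> nat" where
  "co1 n = card (concave_odd1 n)"

definition co2 :: "nat \<Rightarrow> nat" where
  "co2 n = card (concave_odd2 n)"

definition triangular :: "nat \<Rightarrow> bool" where
  "triangular n \<longleftrightarrow> (\<exists>k. n = k * (k + 1) div 2)"

definition co1' :: "nat \<Rightarrow> int" where
  "co1' n = (if triangular n then int (co1 n) - 1 else int (co1 n))"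

definition E :: "(nat \<Rightarrow> int) \<Rightarrow> int \<Rightarrow> int \<Rightarrow> real \<Rightarrow> nat" where
  "E f r a X = card {n. real n < X \<and> [f n = r] (mod a)}"

text \<open>The cardinalities above are not the junk value of an infinite set.\<close>

lemma length_le_Suc_sum_list_decreasing:
  fixes xs :: "nat list"
  shows "sorted_wrt (>) xs \<Longrightarrow> length xs \<le> Suc (sum_list xs)"
proof (induction xs)
  case (Cons x xs)
  show ?case
  proof (cases xs)
    case (Cons y ys)
    with Cons.prems have "x > 0" by auto
    with Cons.IH Cons.prems show ?thesis by simp
  qed simp
qed simp

lemma finite_decreasing_pairs:
  "finite {(as, bs). sorted_wrt (>) as \<and> sorted_wrt (>) bs \<and>
     sum_list as + sum_list bs = (n::nat)}" (is "finite ?S")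
proof -
  let ?L = "{xs. set xs \<subseteq> {..n} \<and> length xs \<le> Suc n}"
  have *: "xs \<in> ?L" if "sorted_wrt (>) xs" "sum_list xs \<le> n" for xs :: "nat list"
    using length_le_Suc_sum_list_decreasing[OF that(1)] that(2) member_le_sum_list[of _ xs]
    by force
  have "?S \<subseteq> ?L \<times> ?L"
  proof (rule subsetI)
    fix p assume "p \<in> ?S"
    then show "p \<in> ?L \<times> ?L" using *[of "fst p"] *[of "snd p"] by (cases p) auto
  qed
  moreover have "finite ?L" by (rule finite_lists_length_le) simp
  ultimately show ?thesis by (meson finite_SigmaI finite_subset)
qed

lemma finite_concave:
  "finite (concave_even n)" "finite (concave_odd1 n)" "finite (concave_odd2 n)"
  by (rule finite_subset[OF _ finite_decreasing_pairs[of n]];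
      auto simp: concave_even_def concave_odd1_def concave_odd2_def)+

lemma finite_E: "finite {n. real n < X \<and> [f n = r] (mod a)}"
proof (rule finite_subset)
  show "{n. real n < X \<and> [f n = r] (mod a)} \<subseteq> {..nat \<lceil>X\<rceil>}"
    by (auto simp: le_nat_iff) linarith
qed simp

end

theory Submission
  imports Defs "HOL-Computational_Algebra.Formal_Power_Series" "HOL-Real_Asymp.Real_Asymp"
begin

text \<open>
  All three bounds rest on one parity principle. The generalized pentagonal numbers cut the
  non-negative integers into intervals; every other one, \<open>[pent k, pent k + 2 k + 1)\<close>, is called a
  block here. For \<open>n\<close> in this block an odd number \<open>2 k + 1\<close> of them is at most \<open>n\<close>. So if the recurrence
  \<open>\<Sum> \<plusminus> u (n - \<omega>)\<close>, over the pentagonal \<open>\<omega> \<le> n\<close>, has an even value, then not all \<open>u (n - \<omega>)\<close> can be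
  odd (\<open>even_witness\<close>). Suppose that this applies to at least \<open>k\<close> elements of each block, about a
  third of all \<open>n < X\<close>. An even value of \<open>u\<close> serves at most one \<open>n\<close> per pentagonal number, so there are
  at least \<open>(\<surd>(24 X + 1) - 14) / 24\<close> of them below \<open>X\<close> (\<open>count_bound\<close>). The bound in part (ii) is
  \<open>(\<surd>(24 X + 1) - 1) / 24 \<cdot> (1 - c / log\<^sup>\<alpha> X)\<close>, which is smaller for large \<open>X\<close>.

  The recurrence computes the coefficients of \<open>(q)\<^sub>\<infinity> \<Sum> u(n) q\<^sup>n\<close>, so these products have to vanish often.
  With \<open>F(q) = \<Sum> (q\<^bsup>pent k\<^esup> - q\<^bsup>pent k + 2 k + 1\<^esup>)\<close>, the pentagonal series with modified signs:

  \<^item> \<open>(q)\<^sub>\<infinity> \<Sum> ce(n) q\<^sup>n = F(q)\<close>; subtracting \<open>(q)\<^sub>\<infinity>\<close> shows that \<open>ce(n)\<close> is even for \<open>n > 0\<close> and that the recurrence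
    for \<open>ce / 2\<close>, with the value at \<open>0\<close> removed, vanishes at all \<open>n\<close> that are not pentagonal.
  \<^item> \<open>(q)\<^sub>\<infinity> \<Sum> co1(n) q\<^sup>n = F(q\<^sup>4)\<close>, while \<open>(q)\<^sub>\<infinity>\<close> times the series over triangular exponents is \<open>(q\<^sup>2; q\<^sup>2)\<^sub>\<infinity>\<^sup>2\<close> by Gauss.
    Both are even functions of \<open>q\<close> and agree modulo \<open>2\<close>, so \<open>co1'\<close> is even and the recurrence for \<open>co1' / 2\<close> vanishes at all odd \<open>n\<close>.
  \<^item> \<open>(q)\<^sub>\<infinity> \<Sum> co2(n) q\<^sup>n\<close> is \<open>1\<close> plus a series in odd powers of \<open>q\<close>, so the recurrence for \<open>co2\<close> vanishes at all even \<open>n > 0\<close>.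

  For these product formulas, lowering all parts until the innermost one is \<open>0\<close> gives the generating functions
  \<open>\<Sum> q\<^bsup>m (m + 1)\<^esup> / ((q)\<^sub>m\<^sup>2 (1 - q\<^bsup>2 m + 2\<^esup>))\<close> for \<open>ce\<close>, the same with \<open>1 - q\<^bsup>2 m + 1\<^esup>\<close> for \<open>co1\<close>, and the latter
  with \<open>q\<^bsup>m m\<^esup>\<close> instead of \<open>q\<^bsup>m (m + 1)\<^esup>\<close> for \<open>co2\<close>. Their last factors are averages of
  \<open>1 / (1 - z q\<^sup>m)\<close> and \<open>1 / (1 + z q\<^sup>m)\<close> with \<open>z = q\<close> or \<open>z\<^sup>2 = q\<close>. Partial fractions of \<open>1 / (z)\<^sub>n\<^sub>+\<^sub>1\<close> and the
  \<open>q\<close>-binomial theorem yield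
  \<open>(q)\<^sub>\<infinity> \<Sum> q\<^bsup>m (m + 1)\<^esup> / ((q)\<^sub>m\<^sup>2 (1 - z q\<^sup>m)) = \<Sum> (-1)\<^sup>n q\<^bsup>n (n + 1) / 2\<^esup> / (z)\<^sub>n\<^sub>+\<^sub>1\<close>
  (\<open>bailey_inversion\<close>, \<open>partial_fractions\<close>), and the Rogers-Fine identity turns the right-hand side into
  false theta functions at \<open>z = - q\<close> and \<open>z\<^sup>2 = q\<close>; its case \<open>z = 1\<close> is the pentagonal number theorem itself.
  All identities are proved for integer power series, modulo \<open>q\<^sup>N\<^sup>+\<^sup>1\<close>.
\<close>

section \<open>Reciprocals and truncated identities of power series\<close>

text \<open>
  Series with constant coefficient \<open>1\<close> are units over every ring, so integer coefficients suffice
  throughout; this is what makes statements modulo \<open>2\<close> and \<open>4\<close> meaningful.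
\<close>
definition recip :: "'a::comm_ring_1 fps \<Rightarrow> 'a fps" where
  "recip f = fps_right_inverse f 1"

lemma mult_recip: "fps_nth f 0 = 1 \<Longrightarrow> f * recip f = 1"
  unfolding recip_def by (rule fps_right_inverse) simp

lemma recip_unique:
  assumes "fps_nth f 0 = 1" "f * g = 1"
  shows "recip f = g"
proof -
  have "recip f = recip f * (f * g)" using assms by simp
  also have "\<dots> = (f * recip f) * g" by (simp add: ac_simps)
  finally show ?thesis using assms by (simp add: mult_recip)
qed

lemma mult_unit_cancel:
  assumes "fps_nth f 0 = 1" "f * a = f * b"
  shows "a = (b :: 'a::comm_ring_1 fps)"
proof -
  have "c = recip f * (f * c)" for c
  proof -
    have "recip f * (f * c) = (f * recip f) * c" by (simp only: ac_simps)
    then show ?thesis by (simp add: mult_recip[OF assms(1)])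
  qed
  then show ?thesis using assms(2) by metis
qed

lemma recip_mult:
  assumes "fps_nth f 0 = 1" "fps_nth g 0 = 1"
  shows "recip (f * g) = recip f * recip g"
proof (rule recip_unique)
  have "f * g * (recip f * recip g) = (f * recip f) * (g * recip g)" by (simp add: ac_simps)
  then show "f * g * (recip f * recip g) = 1" using assms by (simp add: mult_recip)
qed (use assms in simp)

lemma recip_1 [simp]: "recip 1 = 1"
  by (rule recip_unique) auto

text \<open>
  Congruence modulo the principal ideal of \<open>d\<close>. With \<open>d = q ^ Suc N\<close> it expresses an
  identity of infinite sums and products by their truncations at \<open>N\<close>.
\<close>
definition cong_upto :: "'a::comm_ring_1 \<Rightarrow> 'a \<Rightarrow> 'a \<Rightarrow> bool" where
  "cong_upto d a b \<longleftrightarrow> d dvd a - b"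

lemma cong_upto_refl [simp]: "cong_upto d a a"
  by (simp add: cong_upto_def)

lemma cong_upto_sym: "cong_upto d a b \<Longrightarrow> cong_upto d b a"
  unfolding cong_upto_def by (metis dvd_minus_iff minus_diff_eq)

lemma cong_upto_trans [trans]: "cong_upto d a b \<Longrightarrow> cong_upto d b c \<Longrightarrow> cong_upto d a c"
  unfolding cong_upto_def using dvd_add[of d "a - b" "b - c"] by simp

lemma cong_upto_add: "cong_upto d a b \<Longrightarrow> cong_upto d a' b' \<Longrightarrow> cong_upto d (a + a') (b + b')"
  unfolding cong_upto_def using dvd_add[of d "a - b" "a' - b'"] by (simp add: algebra_simps)

lemma cong_upto_diff: "cong_upto d a b \<Longrightarrow> cong_upto d a' b' \<Longrightarrow> cong_upto d (a - a') (b - b')"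
  unfolding cong_upto_def using dvd_diff[of d "a - b" "a' - b'"] by (simp add: algebra_simps)

lemma cong_upto_mult:
  assumes "cong_upto d a b" "cong_upto d a' b'"
  shows "cong_upto d (a * a') (b * b')"
proof -
  have "a * a' - b * b' = (a - b) * a' + b * (a' - b')" by (simp add: algebra_simps)
  then show ?thesis using assms unfolding cong_upto_def by simp
qed

lemma cong_upto_sum:
  "(\<And>i. i \<in> I \<Longrightarrow> cong_upto d (f i) (g i)) \<Longrightarrow> cong_upto d (sum f I) (sum g I)"
  unfolding cong_upto_def by (simp add: sum_subtractf[symmetric] dvd_sum)

lemma cong_upto_dvd: "cong_upto d a b \<Longrightarrow> e dvd d \<Longrightarrow> cong_upto e a b"
  unfolding cong_upto_def using dvd_trans by blast

lemma cong_upto_zero: "d dvd a \<Longrightarrow> cong_upto d (a + b) b"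
  unfolding cong_upto_def by simp

text \<open>
  The lower the precision \<open>e\<close> of a factor, the larger the power of \<open>q\<close> that has to stand
  in front of it. This is how the convergence of all sums below is controlled.
\<close>
lemma cong_upto_scale:
  assumes "cong_upto (q ^ e) a b" "n \<le> e + k" "q ^ k dvd c"
  shows "cong_upto (q ^ n) (c * a) (c * b)"
proof -
  have "q ^ n dvd q ^ e * q ^ k"
    using assms(2) by (simp add: le_imp_power_dvd power_add[symmetric])
  also have "\<dots> dvd (a - b) * c"
    using assms unfolding cong_upto_def by (intro mult_dvd_mono)
  finally show ?thesis unfolding cong_upto_def by (simp add: algebra_simps)
qed

section \<open>Pentagonal numbers and Pochhammer symbols\<close>

lemma choose_two_Suc: "Suc n choose 2 = (n choose 2) + n"
  by (simp add: numeral_2_eq_2)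

lemma zero_choose_two [simp]: "0 choose 2 = 0"
  by (simp add: numeral_2_eq_2)

lemma le_choose_two_Suc: "n \<le> Suc n choose 2"
  by (simp add: choose_two_Suc)

text \<open>
  The generalized pentagonal numbers, in increasing order, are \<open>pent 0 < pent 0 + 1 < pent 1 < pent 1 + 3 <
  pent 2 < pent 2 + 5 < \<dots>\<close>: the numbers \<open>k (3 k - 1) / 2\<close> for \<open>k > 0\<close> are
  the numbers \<open>pent j + 2 * j + 1\<close> with \<open>j = k - 1\<close>.
\<close>
definition pent :: "nat \<Rightarrow> nat" where
  "pent k = k * (3 * k + 1) div 2"

lemma pent_0 [simp]: "pent 0 = 0"
  by (simp add: pent_def)

lemma pent_Suc: "pent (Suc k) = pent k + 3 * k + 2"
proof -
  have "Suc k * (3 * Suc k + 1) = k * (3 * k + 1) + 2 * (3 * k + 2)" by (simp add: algebra_simps)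
  then show ?thesis unfolding pent_def by simp
qed

text \<open>
  The \<open>q\<close>-Pochhammer symbol \<open>(z; q)\<^sub>n\<close>.
\<close>
definition poch :: "'a::comm_ring_1 \<Rightarrow> 'a \<Rightarrow> nat \<Rightarrow> 'a" where
  "poch q z n = (\<Prod>j<n. 1 - z * q ^ j)"

lemma poch_0 [simp]: "poch q z 0 = 1"
  by (simp add: poch_def)

lemma poch_Suc: "poch q z (Suc n) = poch q z n * (1 - z * q ^ n)"
  by (simp add: poch_def)

lemma poch_Suc_shift: "poch q z (Suc n) = (1 - z) * poch q (z * q) n"
  unfolding poch_def by (subst prod.lessThan_Suc_shift) (simp add: mult.assoc)

lemma poch_add: "poch q z (m + n) = poch q z m * poch q (z * q ^ m) n"
  by (induction n) (simp_all add: poch_Suc power_add mult.assoc)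

lemma cong_upto_poch: "z dvd w \<Longrightarrow> cong_upto z (poch q w n) 1"
proof (induction n)
  case (Suc n)
  have "cong_upto z (1 - w * q ^ n) 1"
    using Suc.prems by (simp add: cong_upto_def)
  from cong_upto_mult[OF Suc.IH[OF Suc.prems] this] show ?case by (simp add: poch_Suc)
qed simp

section \<open>Partial fractions and an inversion formula\<close>

context
  fixes q :: "'a::comm_ring_1 fps"
  assumes q0: "fps_nth q 0 = 0"
begin

lemma poch_nth_0: "fps_nth z 0 = 0 \<Longrightarrow> fps_nth (poch q z n) 0 = 1"
  by (induction n) (simp_all add: poch_Suc)

definition qfac where "qfac n = poch q q n"

lemma qfac_0 [simp]: "qfac 0 = 1" by (simp add: qfac_def)

lemma qfac_Suc: "qfac (Suc n) = qfac n * (1 - q ^ Suc n)"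
  by (simp add: qfac_def poch_Suc)

lemma qfac_nth_0 [simp]: "fps_nth (qfac n) 0 = 1"
  unfolding qfac_def by (rule poch_nth_0) (rule q0)

lemma qfac_recip [simp]: "qfac n * recip (qfac n) = 1"
  by (simp add: mult_recip)

lemma recip_qfac_Suc: "(1 - q ^ Suc n) * recip (qfac (Suc n)) = recip (qfac n)"
proof -
  have "recip (qfac (Suc n)) = recip (qfac n) * recip (1 - q ^ Suc n)"
    unfolding qfac_Suc by (rule recip_mult) (use q0 in simp_all)
  moreover have "(1 - q ^ Suc n) * recip (1 - q ^ Suc n) = 1"
    by (rule mult_recip) (use q0 in simp)
  ultimately show ?thesis by (simp only: mult.left_commute[of "1 - q ^ Suc n"] mult_1_right)
qed

definition recip_pair where
  "recip_pair n m = (if m \<le> n then recip (qfac m) * recip (qfac (n - m)) else 0)"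

lemma recip_pair_zero: "m > n \<Longrightarrow> recip_pair n m = 0"
  by (simp add: recip_pair_def)

lemma recip_pair_Suc_0: "(1 - q ^ Suc n) * recip_pair (Suc n) 0 = recip_pair n 0"
  unfolding recip_pair_def using recip_qfac_Suc[of n] by simp

lemma recip_pair_pascal:
  assumes "m \<le> n"
  shows "(1 - q ^ Suc n) * recip_pair (Suc n) (Suc m) = recip_pair n (Suc m) + q ^ (n - m) * recip_pair n m"
proof (cases "m = n")
  case True
  then show ?thesis using recip_qfac_Suc[of n] by (simp add: recip_pair_def)
next
  case False
  define d where "d = n - Suc m"
  have n: "n = Suc (m + d)" "n - m = Suc d" using False assms by (auto simp: d_def)
  have "recip_pair n (Suc m) = recip (qfac (Suc m)) * ((1 - q ^ Suc d) * recip (qfac (Suc d)))"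
    unfolding recip_qfac_Suc by (simp add: recip_pair_def n)
  moreover have "recip_pair n m = ((1 - q ^ Suc m) * recip (qfac (Suc m))) * recip (qfac (Suc d))"
    unfolding recip_qfac_Suc by (simp add: recip_pair_def n Suc_diff_le)
  moreover have "recip_pair (Suc n) (Suc m) = recip (qfac (Suc m)) * recip (qfac (Suc d))"
    by (simp add: recip_pair_def n Suc_diff_le)
  moreover have "q ^ Suc n = q ^ Suc d * q ^ Suc m"
    by (simp add: n power_add)
  ultimately show ?thesis unfolding n(2) by (simp only:) (simp only: algebra_simps mult_1_left mult_1_right)
qed

text \<open>
  The coefficients are those of the Gauss binomial theorem divided by \<open>(q)\<^sub>n\<close>, with the powers
  of the variable replaced by an arbitrary \<open>g\<close>. The recurrence \<open>altsum_Suc\<close> evaluates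
  the sum whenever a shift of \<open>g\<close> is a multiple of a function of the same family.
\<close>
definition altsum where
  "altsum n g = (\<Sum>m\<le>n. (- 1) ^ m * q ^ (m choose 2) * recip_pair n m * g m)"

lemma altsum_0 [simp]: "altsum 0 g = g 0"
  by (simp add: altsum_def recip_pair_def)

lemma altsum_Suc: "(1 - q ^ Suc n) * altsum (Suc n) g = altsum n g - q ^ n * altsum n (\<lambda>m. g (Suc m))"
proof -
  let ?t = "\<lambda>m. (- 1) ^ m * q ^ (m choose 2)"
  have "(1 - q ^ Suc n) * altsum (Suc n) g
      = (\<Sum>m\<le>Suc n. ?t m * g m * ((1 - q ^ Suc n) * recip_pair (Suc n) m))"
    unfolding altsum_def sum_distrib_left by (rule sum.cong) (simp_all add: ac_simps)
  also have "\<dots> = g 0 * recip_pair n 0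
      + (\<Sum>m\<le>n. ?t (Suc m) * g (Suc m) * (recip_pair n (Suc m) + q ^ (n - m) * recip_pair n m))"
    by (subst sum.atMost_Suc_shift) (simp add: recip_pair_Suc_0 recip_pair_pascal del: power_Suc)
  also have "\<dots> = (g 0 * recip_pair n 0 + (\<Sum>m\<le>n. ?t (Suc m) * g (Suc m) * recip_pair n (Suc m)))
      + (\<Sum>m\<le>n. ?t (Suc m) * g (Suc m) * (q ^ (n - m) * recip_pair n m))"
    by (simp add: sum.distrib algebra_simps del: power_Suc)
  also have "g 0 * recip_pair n 0 + (\<Sum>m\<le>n. ?t (Suc m) * g (Suc m) * recip_pair n (Suc m))
      = (\<Sum>m\<le>Suc n. ?t m * g m * recip_pair n m)"
    by (subst sum.atMost_Suc_shift) simp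
  also have "\<dots> = altsum n g"
    by (simp add: altsum_def recip_pair_zero ac_simps)
  also have "(\<Sum>m\<le>n. ?t (Suc m) * g (Suc m) * (q ^ (n - m) * recip_pair n m))
      = - (q ^ n * altsum n (\<lambda>m. g (Suc m)))"
    unfolding altsum_def sum_distrib_left sum_negf[symmetric]
  proof (rule sum.cong)
    fix m assume "m \<in> {..n}"
    then have e: "q ^ (Suc m choose 2) * q ^ (n - m) = q ^ n * q ^ (m choose 2)"
      by (simp add: choose_two_Suc power_add[symmetric] add.commute)
    have "?t (Suc m) * g (Suc m) * (q ^ (n - m) * recip_pair n m)
        = - ((q ^ (Suc m choose 2) * q ^ (n - m)) * ((- 1) ^ m * g (Suc m) * recip_pair n m))"
      by (simp add: ac_simps)
    then show "?t (Suc m) * g (Suc m) * (q ^ (n - m) * recip_pair n m)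
        = - (q ^ n * (?t m * recip_pair n m * g (Suc m)))"
      unfolding e by (simp add: ac_simps)
  qed simp
  finally show ?thesis by simp
qed

lemma altsum_scale: "altsum n (\<lambda>m. c * g m) = c * altsum n g"
  by (simp add: altsum_def sum_distrib_left ac_simps)

text \<open>
  The shift \<open>m \<mapsto> m + 1\<close> turns the summand for \<open>z\<close> into \<open>q\<close> times
  the one for \<open>z q\<close>, so the recurrence reduces the claim to \<open>1 / (z)\<^sub>n - q\<^sup>n / (z
  q)\<^sub>n = (1 - q\<^sup>n) / (z)\<^sub>n\<^sub>+\<^sub>1\<close>.
\<close>
lemma partial_fractions:
  assumes "fps_nth z 0 = 0"
  shows "altsum n (\<lambda>m. q ^ m * recip (1 - z * q ^ m)) = recip (poch q z (Suc n))"
  using assms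
proof (induction n arbitrary: z)
  case 0
  then show ?case by (simp add: poch_Suc)
next
  case (Suc n)
  let ?r = "recip (poch q z (Suc (Suc n)))"
  have z: "fps_nth (z * q ^ k) 0 = 0" "fps_nth (z * q) 0 = 0" for k using Suc.prems by auto
  have 1: "recip (poch q z (Suc n)) = (1 - z * q ^ Suc n) * ?r"
  proof (rule recip_unique)
    show "poch q z (Suc n) * ((1 - z * q ^ Suc n) * ?r) = 1"
      using mult_recip[of "poch q z (Suc (Suc n))"] poch_nth_0[OF Suc.prems, of "Suc (Suc n)"]
      by (simp add: poch_Suc[of q z "Suc n"] mult.assoc del: power_Suc)
  qed (rule poch_nth_0[OF Suc.prems])
  have 2: "recip (poch q (z * q) (Suc n)) = (1 - z) * ?r"
  proof (rule recip_unique)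
    show "poch q (z * q) (Suc n) * ((1 - z) * ?r) = 1"
      using mult_recip[of "poch q z (Suc (Suc n))"] poch_nth_0[OF Suc.prems, of "Suc (Suc n)"]
      by (simp add: poch_Suc_shift[of q z "Suc n"] ac_simps)
  qed (rule poch_nth_0[OF z(2)])
  have 3: "altsum n (\<lambda>m. q ^ Suc m * recip (1 - z * q ^ Suc m))
      = q * altsum n (\<lambda>m. q ^ m * recip (1 - z * q * q ^ m))"
    unfolding altsum_scale[symmetric] by (simp add: ac_simps)
  have "(1 - q ^ Suc n) * altsum (Suc n) (\<lambda>m. q ^ m * recip (1 - z * q ^ m))
    = recip (poch q z (Suc n)) - q ^ n * (q * altsum n (\<lambda>m. q ^ m * recip (1 - z * q * q ^ m)))"
    unfolding altsum_Suc Suc.IH[OF Suc.prems] 3 by (rule refl)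
  also have "\<dots> = (1 - q ^ Suc n) * ?r"
    unfolding Suc.IH[OF z(2)] 1 2 by (simp add: algebra_simps)
  finally show ?case
    by (rule mult_unit_cancel[rotated]) (simp add: q0)
qed

text \<open>
  The induction runs over the family with an additional factor \<open>y ^ k\<close>, because the recurrence lowers
  \<open>n\<close> in both of its terms but the exponent of \<open>y\<close> only in the shifted one.
\<close>
lemma q_binomial:
  "qfac n * altsum n (\<lambda>m. x ^ m * y ^ (n - m)) = (\<Prod>j<n. y - x * q ^ j)"
proof -
  have "qfac n * altsum n (\<lambda>m. x ^ m * y ^ (k + n - m)) = y ^ k * (\<Prod>j<n. y - x * q ^ j)" for k
  proof (induction n arbitrary: k)
    case (Suc n)
    have "qfac (Suc n) * altsum (Suc n) (\<lambda>m. x ^ m * y ^ (k + Suc n - m))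
        = qfac n * ((1 - q ^ Suc n) * altsum (Suc n) (\<lambda>m. x ^ m * y ^ (k + Suc n - m)))"
      by (simp add: qfac_Suc mult.assoc del: power_Suc)
    also have "\<dots> = qfac n * altsum n (\<lambda>m. x ^ m * y ^ (Suc k + n - m))
        - q ^ n * x * (qfac n * altsum n (\<lambda>m. x ^ m * y ^ (k + n - m)))"
    proof -
      have "altsum n (\<lambda>m. x ^ Suc m * y ^ (k + Suc n - Suc m)) = x * altsum n (\<lambda>m. x ^ m * y ^ (k + n - m))"
        unfolding altsum_scale[symmetric] by (simp add: ac_simps)
      then show ?thesis unfolding altsum_Suc by (simp add: algebra_simps)
    qed
    also have "\<dots> = y ^ k * (\<Prod>j<Suc n. y - x * q ^ j)"
      unfolding Suc.IH by (simp add: algebra_simps)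
    finally show ?case .
  qed simp
  from this[of 0] show ?thesis by simp
qed

lemma altsum_const: "altsum n (\<lambda>m. 1) = (if n = 0 then 1 else 0)"
proof (cases n)
  case (Suc k)
  have "qfac n * altsum n (\<lambda>m. 1) = qfac n * 0"
    using q_binomial[of n 1 1] by (simp add: Suc prod.lessThan_Suc_shift del: prod.lessThan_Suc)
  then show ?thesis using Suc mult_unit_cancel[OF qfac_nth_0] by auto
qed simp

lemma altsum_power:
  "altsum n (\<lambda>m. x ^ m) = recip (qfac n) * poch q x n"
proof -
  have "qfac n * altsum n (\<lambda>m. x ^ m) = qfac n * (recip (qfac n) * poch q x n)"
    using q_binomial[of n x 1] by (simp add: poch_def mult.assoc[symmetric])
  then show ?thesis by (rule mult_unit_cancel[rotated]) simp
qed

text \<open>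
  After exchanging the two sums, the inner sum over \<open>n = m + l\<close> is the \<open>q\<close>-binomial
  theorem at \<open>q ^ Suc m\<close>, whose product \<open>(1 - q\<^sup>m\<^sup>+\<^sup>1) \<dots> (1 -
  q\<^sup>N)\<close> is \<open>(q)\<^sub>N / (q)\<^sub>m\<close>. As \<open>g\<close> is arbitrary, one identity
  serves the partial fractions, Durfee's identity and Euler's identity alike.
\<close>
lemma bailey_inversion:
  "(\<Sum>n\<le>N. (- 1) ^ n * q ^ (Suc n choose 2) * recip (qfac (N - n)) * altsum n g)
   = qfac N * (\<Sum>m\<le>N. q ^ m\<^sup>2 * g m * recip (qfac m) ^ 2 * recip (qfac (N - m)))"
proof -
  let ?s = "\<lambda>n. (- 1) ^ n :: 'a fps"
  have rearrange: "s * a * r * (s' * a' * b * c) = e1 * c * p * (s'' * e2 * b'' * e3)"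
    if "a * a' = e1 * e2 * e3" "s * s' = s''" "r * b = p * b''"
    for s a r s' a' b c e1 p s'' e2 b'' e3 :: "'a fps"
  proof -
    have "s * a * r * (s' * a' * b * c) = (a * a') * (s * s') * (r * b) * c"
      by (simp only: ac_simps)
    then show ?thesis by (simp only: that) (simp only: ac_simps)
  qed
  have *: "(\<Sum>l\<le>N-m. ?s (m + l) * q ^ (Suc (m + l) choose 2) * recip (qfac (N - (m + l)))
            * (?s m * q ^ (m choose 2) * recip_pair (m + l) m * g m))
          = qfac N * (q ^ m\<^sup>2 * g m * recip (qfac m) ^ 2 * recip (qfac (N - m)))" (is "?lhs = _") if "m \<le> N" for m
  proof -
    have e: "(Suc (m + l) choose 2) + (m choose 2) = m\<^sup>2 + m * l + l + (l choose 2)" for l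
    proof -
      have "(m choose 2) * 2 + m = m\<^sup>2" for m :: nat
        by (induction m) (simp_all add: choose_two_Suc power2_eq_square)
      from this[of "m + l"] this[of m] this[of l] show ?thesis
        by (simp add: choose_two_Suc power2_eq_square algebra_simps)
    qed
    have "?lhs = (\<Sum>l\<le>N-m. q ^ m\<^sup>2 * g m * recip (qfac m) *
             (?s l * q ^ (l choose 2) * recip_pair (N - m) l * (q ^ Suc m) ^ l))"
    proof (rule sum.cong)
      fix l assume l: "l \<in> {..N - m}"
      have "q ^ (Suc (m + l) choose 2) * q ^ (m choose 2) = q ^ m\<^sup>2 * q ^ (l choose 2) * (q ^ Suc m) ^ l"
        unfolding power_mult[symmetric] power_add[symmetric] e by (simp add: algebra_simps)
      moreover have "?s (m + l) * ?s m = ?s l"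
        by (simp add: power_add mult.commute mult.left_commute flip: power_mult_distrib)
      moreover have "recip (qfac (N - (m + l))) * recip_pair (m + l) m = recip (qfac m) * recip_pair (N - m) l"
        using l by (simp add: recip_pair_def)
      ultimately show "?s (m + l) * q ^ (Suc (m + l) choose 2) * recip (qfac (N - (m + l)))
            * (?s m * q ^ (m choose 2) * recip_pair (m + l) m * g m)
          = q ^ m\<^sup>2 * g m * recip (qfac m) * (?s l * q ^ (l choose 2) * recip_pair (N - m) l * (q ^ Suc m) ^ l)"
        by (intro rearrange)
    qed simp
    also have "\<dots> = q ^ m\<^sup>2 * g m * recip (qfac m) * altsum (N - m) (\<lambda>l. (q ^ Suc m) ^ l)"
      by (simp add: altsum_def sum_distrib_left)
    also have "\<dots> = q ^ m\<^sup>2 * g m * recip (qfac m) * recip (qfac (N - m)) * poch q (q * q ^ m) (N - m)"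
      by (simp add: altsum_power ac_simps)
    also have "poch q (q * q ^ m) (N - m) = recip (qfac m) * (qfac m * poch q (q * q ^ m) (N - m))"
      by (simp add: mult.assoc[symmetric] mult.commute[of "recip (qfac m)"])
    also have "qfac m * poch q (q * q ^ m) (N - m) = qfac N"
      using poch_add[of q q m "N - m"] that by (simp add: qfac_def)
    finally show ?thesis by (simp add: power2_eq_square ac_simps)
  qed
  have "(\<Sum>n\<le>N. ?s n * q ^ (Suc n choose 2) * recip (qfac (N - n)) * altsum n g)
     = (\<Sum>n\<le>N. \<Sum>m\<le>n. ?s n * q ^ (Suc n choose 2) * recip (qfac (N - n))
            * (?s m * q ^ (m choose 2) * recip_pair n m * g m))"
    by (simp add: altsum_def sum_distrib_left)
  also have "\<dots> = (\<Sum>m\<le>N. \<Sum>n=m..N. ?s n * q ^ (Suc n choose 2) * recip (qfac (N - n))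
            * (?s m * q ^ (m choose 2) * recip_pair n m * g m))"
    unfolding sum.Sigma[OF finite_atMost ballI[OF finite_atMost]]
      sum.Sigma[OF finite_atMost ballI[OF finite_atLeastAtMost]]
    by (rule sum.reindex_bij_witness[of _ "\<lambda>(a, b). (b, a)" "\<lambda>(a, b). (b, a)"]) auto
  also have "\<dots> = (\<Sum>m\<le>N. \<Sum>l\<le>N-m. ?s (m + l) * q ^ (Suc (m + l) choose 2) * recip (qfac (N - (m + l)))
            * (?s m * q ^ (m choose 2) * recip_pair (m + l) m * g m))"
  proof (rule sum.cong)
    fix m assume "m \<in> {..N}"
    then show "(\<Sum>n=m..N. ?s n * q ^ (Suc n choose 2) * recip (qfac (N - n))
            * (?s m * q ^ (m choose 2) * recip_pair n m * g m))
       = (\<Sum>l\<le>N-m. ?s (m + l) * q ^ (Suc (m + l) choose 2) * recip (qfac (N - (m + l)))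
            * (?s m * q ^ (m choose 2) * recip_pair (m + l) m * g m))"
      by (intro sum.reindex_bij_witness[of _ "\<lambda>l. m + l" "\<lambda>n. n - m"]) auto
  qed simp
  finally show ?thesis by (simp add: * sum_distrib_left)
qed


text \<open>
  The ratio is a product of factors \<open>1 - q ^ j\<close> with \<open>j > m\<close>.
\<close>
lemma cong_upto_qfac_ratio:
  assumes "m \<le> N"
  shows "cong_upto (q ^ Suc m) (qfac N * recip (qfac m)) 1"
proof -
  have "qfac N * recip (qfac m) = (qfac m * recip (qfac m)) * poch q (q * q ^ m) (N - m)"
    using poch_add[of q q m "N - m"] assms by (simp add: qfac_def ac_simps)
  then show ?thesis using cong_upto_poch[of "q ^ Suc m" "q * q ^ m" q "N - m"] by simp
qed

text \<open>
  The limit \<open>N \<rightarrow> \<infinity>\<close> of \<open>bailey_inversion\<close>: after multiplication by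
  \<open>(q)\<^sub>N\<close>, the remaining factors \<open>(q)\<^sub>N / (q)\<^sub>N\<^sub>-\<^sub>m\<close>
  differ from \<open>1\<close> only by high powers of \<open>q\<close>.
\<close>
lemma bailey_inversion_upto:
  "cong_upto (q ^ Suc N) (qfac N * (\<Sum>m\<le>N. q ^ m\<^sup>2 * g m * recip (qfac m) ^ 2))
     (\<Sum>n\<le>N. (- 1) ^ n * q ^ (Suc n choose 2) * altsum n g)"
proof -
  let ?rogers_fine_sum = "qfac N * (\<Sum>n\<le>N. (- 1) ^ n * q ^ (Suc n choose 2) * recip (qfac (N - n)) * altsum n g)"
  have "?rogers_fine_sum = qfac N * (\<Sum>m\<le>N. (q ^ m\<^sup>2 * g m * recip (qfac m) ^ 2) * (qfac N * recip (qfac (N - m))))"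
    unfolding bailey_inversion by (simp add: sum_distrib_left ac_simps)
  also have "cong_upto (q ^ Suc N) \<dots> (qfac N * (\<Sum>m\<le>N. (q ^ m\<^sup>2 * g m * recip (qfac m) ^ 2) * 1))"
  proof (rule cong_upto_mult[OF cong_upto_refl], rule cong_upto_sum)
    fix m assume m: "m \<in> {..N}"
    have "q ^ m dvd q ^ m\<^sup>2 * g m * recip (qfac m) ^ 2"
      by (simp add: mult.assoc le_imp_power_dvd power2_eq_square dvd_mult2)
    with m show "cong_upto (q ^ Suc N) (q ^ m\<^sup>2 * g m * recip (qfac m) ^ 2 * (qfac N * recip (qfac (N - m))))
        (q ^ m\<^sup>2 * g m * recip (qfac m) ^ 2 * 1)"
      by (intro cong_upto_scale[where e = "Suc (N - m)" and k = m] cong_upto_qfac_ratio) auto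
  qed
  finally have 1: "cong_upto (q ^ Suc N) ?rogers_fine_sum (qfac N * (\<Sum>m\<le>N. q ^ m\<^sup>2 * g m * recip (qfac m) ^ 2))"
    by simp
  have "?rogers_fine_sum = (\<Sum>n\<le>N. ((- 1) ^ n * q ^ (Suc n choose 2) * altsum n g) * (qfac N * recip (qfac (N - n))))"
    by (simp add: sum_distrib_left ac_simps)
  also have "cong_upto (q ^ Suc N) \<dots> (\<Sum>n\<le>N. ((- 1) ^ n * q ^ (Suc n choose 2) * altsum n g) * 1)"
  proof (rule cong_upto_sum)
    fix n assume n: "n \<in> {..N}"
    have "q ^ n dvd (- 1) ^ n * q ^ (Suc n choose 2) * altsum n g"
      by (simp add: mult.assoc le_imp_power_dvd le_choose_two_Suc dvd_mult dvd_mult2)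
    with n show "cong_upto (q ^ Suc N)
        ((- 1) ^ n * q ^ (Suc n choose 2) * altsum n g * (qfac N * recip (qfac (N - n))))
        ((- 1) ^ n * q ^ (Suc n choose 2) * altsum n g * 1)"
      by (intro cong_upto_scale[where e = "Suc (N - n)" and k = n] cong_upto_qfac_ratio) auto
  qed
  finally show ?thesis using 1 cong_upto_sym cong_upto_trans by fastforce
qed

text \<open>
  Durfee's identity \<open>\<Sum> q\<^bsup>m m\<^esup> / (q)\<^sub>m\<^sup>2 = 1 / (q)\<^sub>\<infinity>\<close>,
  the case \<open>g = 1\<close>.
\<close>
lemma durfee_upto: "cong_upto (q ^ Suc N) (qfac N * (\<Sum>m\<le>N. q ^ m\<^sup>2 * recip (qfac m) ^ 2)) 1"
proof -
  have "(\<Sum>n\<le>N. (- 1) ^ n * q ^ (Suc n choose 2) * altsum n (\<lambda>m. 1))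
      = (\<Sum>n\<le>N. if n = 0 then 1 else 0)"
    by (rule sum.cong) (simp_all add: altsum_const choose_two_Suc)
  then show ?thesis using bailey_inversion_upto[of N "\<lambda>m. 1"] by simp
qed

text \<open>
  Euler's expansion of \<open>(q)\<^sub>\<infinity>\<close>, the case where \<open>g\<close> is the indicator
  function of \<open>0\<close>.
\<close>
lemma euler_upto:
  "cong_upto (q ^ Suc N) (qfac N) (\<Sum>n\<le>N. (- 1) ^ n * q ^ (Suc n choose 2) * recip (qfac n))"
proof -
  have "poch q 0 n = 1" for n by (simp add: poch_def)
  then have "altsum n (\<lambda>m. 0 ^ m) = recip (qfac n)" for n by (simp add: altsum_power)
  moreover have "(\<Sum>m\<le>N. q ^ m\<^sup>2 * 0 ^ m * recip (qfac m) ^ 2) = (\<Sum>m\<le>N. if m = 0 then 1 else 0)"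
    by (rule sum.cong) (auto simp: power_0_left)
  ultimately show ?thesis using bailey_inversion_upto[of N "\<lambda>m. 0 ^ m"] by simp
qed

section \<open>The Rogers-Fine identity and the pentagonal number theorem\<close>

definition rogers_fine_sum where
  "rogers_fine_sum N x z = (\<Sum>n\<le>N. (- 1) ^ n * x ^ n * q ^ (Suc n choose 2) * recip (poch q (z * q) n))"

lemma recip_poch_Suc:
  assumes "fps_nth z 0 = 0"
  shows "recip (poch q z n) = (1 - z * q ^ n) * recip (poch q z (Suc n))"
proof (rule recip_unique)
  show "poch q z n * ((1 - z * q ^ n) * recip (poch q z (Suc n))) = 1"
    using mult_recip[of "poch q z (Suc n)"] poch_nth_0[OF assms, of "Suc n"]
    by (simp add: poch_Suc[of q z n] mult.assoc)
qed (rule poch_nth_0[OF assms])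

lemma recip_poch_Suc_shift:
  assumes "fps_nth z 0 = 0"
  shows "recip (poch q z (Suc n)) = recip (1 - z) * recip (poch q (z * q) n)"
  unfolding poch_Suc_shift using assms by (intro recip_mult poch_nth_0) auto

text \<open>
  The contiguous relation behind the Rogers-Fine identity. Written with the summands \<open>w\<close> of the
  left-hand side alone it telescopes, and the boundary terms at \<open>N\<close> are of high order in
  \<open>q\<close>.
\<close>
lemma rogers_fine_step:
  "cong_upto (q ^ Suc N) (rogers_fine_sum N x z)
     (1 - x * q - q\<^sup>2 * x * (z - x * q) * recip (1 - z * q) * rogers_fine_sum N (x * q\<^sup>2) (z * q))"
proof -
  define w where "w n = (- 1) ^ n * x ^ n * q ^ (Suc n choose 2) * recip (poch q (z * q) n)" for n
  define v where "v n = (- 1) ^ n * x ^ n * q ^ (2 * n) * q ^ (Suc n choose 2)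
      * recip (poch q (z * q) (Suc n))" for n
  have zq: "fps_nth (z * q) 0 = 0" by (simp add: q0)
  note d = recip_poch_Suc[OF zq]
  have sum_w: "rogers_fine_sum N x z = (\<Sum>n\<le>N. w n)" by (simp add: rogers_fine_sum_def w_def)
  have sum_v: "recip (1 - z * q) * rogers_fine_sum N (x * q\<^sup>2) (z * q) = (\<Sum>n\<le>N. v n)"
    unfolding rogers_fine_sum_def v_def recip_poch_Suc_shift[OF zq] sum_distrib_left
    by (rule sum.cong) (simp_all add: power_mult_distrib power_mult[symmetric] ac_simps)
  \<comment> \<open>the part of the right-hand side in \<open>z\<close> is a multiple of \<open>w (n + 1)\<close>, the other part one of \<open>w (n + 2)\<close>\<close>
  have w: "w n + q\<^sup>2 * x * (z - x * q) * v n
      = (w n - w (n + 2)) + (z * q ^ (n + 2) * w (n + 2) - z * q ^ (n + 1) * w (n + 1))" for n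
  proof -
    define a where "a = (- 1) ^ n * x ^ n * q ^ (Suc n choose 2)"
    define c where "c = q ^ n"
    define r where "r = recip (poch q (z * q) (Suc (Suc n)))"
    have r: "recip (poch q (z * q) (Suc n)) = (1 - z * q\<^sup>2 * c) * r"
      unfolding d[of "Suc n"] r_def c_def by (simp add: power2_eq_square ac_simps)
    moreover have "w (n + 1) = - a * x * q * c * recip (poch q (z * q) (Suc n))"
      unfolding w_def a_def c_def by (simp add: choose_two_Suc power_add ac_simps)
    moreover have "w (n + 2) = a * x\<^sup>2 * q ^ 3 * c\<^sup>2 * r"
      unfolding w_def a_def c_def r_def
      by (simp add: choose_two_Suc power_add power2_eq_square eval_nat_numeral ac_simps)
    moreover have "v n = a * c\<^sup>2 * recip (poch q (z * q) (Suc n))"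
      unfolding v_def a_def c_def by (simp add: power_mult[symmetric] ac_simps)
    moreover have "w n = a * recip (poch q (z * q) n)"
      by (simp add: w_def a_def)
    moreover have "q ^ (n + 2) = q * q * c" "q ^ (n + 1) = q * c"
      by (simp_all add: c_def)
    ultimately show ?thesis
      unfolding r by (simp only:) (simp add: power2_eq_square power3_eq_cube algebra_simps)
  qed
  have "rogers_fine_sum N x z + q\<^sup>2 * x * (z - x * q) * recip (1 - z * q) * rogers_fine_sum N (x * q\<^sup>2) (z * q)
      = (\<Sum>n\<le>N. w n + q\<^sup>2 * x * (z - x * q) * v n)"
    unfolding sum_w mult.assoc[of _ "recip (1 - z * q)"] sum_v by (simp add: sum.distrib sum_distrib_left)
  also have "\<dots> = (w 0 + w 1 - w (N + 1) - w (N + 2)) + (z * q ^ (N + 2) * w (N + 2) - z * q * w 1)"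
    unfolding w by (induction N) simp_all
  also have "\<dots> = 1 - x * q - (w (N + 1) + (1 - z * q ^ (N + 2)) * w (N + 2))"
  proof -
    have "w 0 = 1" by (simp add: w_def choose_two_Suc)
    moreover have "(1 - z * q) * w 1 = - x * q"
      using mult_recip[of "1 - z * q"] q0 by (simp add: w_def choose_two_Suc poch_Suc ac_simps)
    ultimately show ?thesis by (simp add: algebra_simps)
  qed
  finally have "rogers_fine_sum N x z - (1 - x * q - q\<^sup>2 * x * (z - x * q) * recip (1 - z * q) * rogers_fine_sum N (x * q\<^sup>2) (z * q))
      = - (w (N + 1) + (1 - z * q ^ (N + 2)) * w (N + 2))"
    by (simp add: algebra_simps)
  moreover have "q ^ Suc N dvd w n" if "n > N" for n
    unfolding w_def mult.assoc using that le_choose_two_Suc[of n]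
    by (intro dvd_mult dvd_mult2 le_imp_power_dvd) linarith
  ultimately show ?thesis unfolding cong_upto_def by (simp add: dvd_mult)
qed

text \<open>
  The product of the first \<open>k\<close> factors picked up when \<open>rogers_fine_step\<close> is iterated
  from \<open>x = 1\<close>.
\<close>
definition rogers_fine_term where
  "rogers_fine_term z k = (- 1) ^ k * q ^ pent k * (\<Prod>i<k. z - q ^ Suc i) * recip (poch q (z * q) k)"

text \<open>
  Each iteration replaces \<open>(x, z)\<close> by \<open>(x q\<^sup>2, z q)\<close>; after \<open>N + 1\<close>
  of them the remainder carries the factor \<open>q ^ pent (Suc N)\<close>.
\<close>
lemma rogers_fine:
  "cong_upto (q ^ Suc N) (rogers_fine_sum N 1 z) (\<Sum>k\<le>N. rogers_fine_term z k * (1 - q ^ (2 * k + 1)))"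
proof -
  have "cong_upto (q ^ Suc N) (rogers_fine_sum N 1 z)
      ((\<Sum>k<M. rogers_fine_term z k * (1 - q ^ (2 * k + 1))) + rogers_fine_term z M * rogers_fine_sum N (q ^ (2 * M)) (z * q ^ M))" for M
  proof (induction M)
    case 0
    then show ?case by (simp add: rogers_fine_term_def pent_def)
  next
    case (Suc M)
    let ?r = "recip (1 - z * q ^ M * q)"
    have zq: "fps_nth (z * q) 0 = 0" by (simp add: q0)
    have "recip (poch q (z * q) (Suc M)) = recip (poch q (z * q) M) * ?r"
      unfolding poch_Suc using q0 by (subst recip_mult) (simp_all add: poch_nth_0 ac_simps)
    then have rogers_fine_term: "rogers_fine_term z (Suc M) = - (rogers_fine_term z M * (q ^ (3 * M + 2) * (z - q ^ Suc M) * ?r))"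
      unfolding rogers_fine_term_def pent_Suc by (simp add: power_add ac_simps)
    have "cong_upto (q ^ Suc N) (rogers_fine_term z M * rogers_fine_sum N (q ^ (2 * M)) (z * q ^ M))
       (rogers_fine_term z M * (1 - q ^ (2 * M) * q - q\<^sup>2 * q ^ (2 * M) * (z * q ^ M - q ^ (2 * M) * q) * ?r
          * rogers_fine_sum N (q ^ (2 * M) * q\<^sup>2) (z * q ^ M * q)))"
      by (intro cong_upto_mult cong_upto_refl rogers_fine_step)
    also have "rogers_fine_term z M * (1 - q ^ (2 * M) * q - q\<^sup>2 * q ^ (2 * M) * (z * q ^ M - q ^ (2 * M) * q) * ?r
          * rogers_fine_sum N (q ^ (2 * M) * q\<^sup>2) (z * q ^ M * q))
       = rogers_fine_term z M * (1 - q ^ (2 * M + 1)) + rogers_fine_term z (Suc M) * rogers_fine_sum N (q ^ (2 * Suc M)) (z * q ^ Suc M)"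
    proof -
      have 1: "q\<^sup>2 * q ^ (2 * M) * (z * q ^ M - q ^ (2 * M) * q) = q ^ (3 * M + 2) * (z - q ^ Suc M)"
        by (simp add: power_add power_mult power2_eq_square power3_eq_cube power_mult_distrib algebra_simps)
      have 2: "q ^ (2 * M) * q\<^sup>2 = q ^ (2 * Suc M)"
        by (simp add: power2_eq_square)
      have 3: "rogers_fine_sum N a (z * q ^ M * q) = rogers_fine_sum N a (z * q ^ Suc M)" for a
        by (simp add: ac_simps)
      show ?thesis unfolding 1 2 3 rogers_fine_term by (simp add: algebra_simps)
    qed
    finally show ?case
      using cong_upto_trans[OF Suc.IH cong_upto_add[OF cong_upto_refl]] by (simp add: add.assoc)
  qed
  from this[of "Suc N"] have "cong_upto (q ^ Suc N) (rogers_fine_sum N 1 z)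
      (rogers_fine_term z (Suc N) * rogers_fine_sum N (q ^ (2 * Suc N)) (z * q ^ Suc N) + (\<Sum>k\<le>N. rogers_fine_term z k * (1 - q ^ (2 * k + 1))))"
    by (simp only: lessThan_Suc_atMost add.commute)
  also have "cong_upto (q ^ Suc N) \<dots> (\<Sum>k\<le>N. rogers_fine_term z k * (1 - q ^ (2 * k + 1)))"
  proof (rule cong_upto_zero)
    have "q ^ Suc N dvd q ^ pent (Suc N)"
      by (rule le_imp_power_dvd) (simp add: pent_Suc)
    then show "q ^ Suc N dvd rogers_fine_term z (Suc N) * rogers_fine_sum N (q ^ (2 * Suc N)) (z * q ^ Suc N)"
      unfolding rogers_fine_term_def by (simp only: dvd_mult dvd_mult2)
  qed
  finally show ?thesis .
qed

text \<open>
  Euler's pentagonal number theorem: at \<open>z = 1\<close> the products in numerator and denominator of the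
  Rogers-Fine terms cancel, and the left-hand side is Euler's expansion of \<open>(q)\<^sub>\<infinity>\<close>.
\<close>
lemma pentagonal_upto:
  "cong_upto (q ^ Suc N) (qfac N) (\<Sum>k\<le>N. (- 1) ^ k * (q ^ pent k - q ^ (pent k + 2 * k + 1)))"
proof -
  have sum_w: "rogers_fine_sum N 1 1 = (\<Sum>n\<le>N. (- 1) ^ n * q ^ (Suc n choose 2) * recip (qfac n))"
    by (simp add: rogers_fine_sum_def qfac_def)
  have "rogers_fine_term 1 k * (1 - q ^ (2 * k + 1)) = (- 1) ^ k * (q ^ pent k - q ^ (pent k + 2 * k + 1))" for k
  proof -
    have "(\<Prod>i<k. 1 - q ^ Suc i) * recip (poch q q k) = 1"
      using qfac_recip[of k] by (simp add: qfac_def poch_def)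
    then have "rogers_fine_term 1 k = (- 1) ^ k * q ^ pent k"
      unfolding rogers_fine_term_def by (simp add: mult.assoc)
    then show ?thesis by (simp add: algebra_simps power_add)
  qed
  then show ?thesis
    using cong_upto_trans[OF euler_upto rogers_fine[of N 1, unfolded sum_w]] by simp
qed

section \<open>Special values as false theta functions\<close>

text \<open>
  The series \<open>(q)\<^sub>\<infinity> \<Sum> q\<^bsup>m (m + 1)\<^esup> / ((q)\<^sub>m\<^sup>2 (1 - z
  q\<^sup>m))\<close>. The average of its values at \<open>z\<close> and \<open>- z\<close> is
  \<open>(q)\<^sub>\<infinity>\<close> times the generating function of \<open>ce\<close> for \<open>z = q\<close>
  and of \<open>co1\<close> for \<open>z\<^sup>2 = q\<close>.
\<close>
definition appell_sum where
  "appell_sum N z = qfac N * (\<Sum>m\<le>N. q ^ m\<^sup>2 * (q ^ m * recip (1 - z * q ^ m)) * recip (qfac m) ^ 2)"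

text \<open>
  Partial fractions turn the series into \<open>\<Sum> (-1)\<^sup>n q\<^bsup>n (n + 1) / 2\<^esup> /
  (z)\<^sub>n\<^sub>+\<^sub>1\<close>, to which the Rogers-Fine identity applies.
\<close>
lemma appell_sum_upto:
  assumes "fps_nth z 0 = 0"
  shows "cong_upto (q ^ Suc N) (appell_sum N z) (\<Sum>k\<le>N. recip (1 - z) * rogers_fine_term z k * (1 - q ^ (2 * k + 1)))"
proof -
  have "cong_upto (q ^ Suc N) (appell_sum N z) (recip (1 - z) * rogers_fine_sum N 1 z)"
    using bailey_inversion_upto[of N "\<lambda>m. q ^ m * recip (1 - z * q ^ m)"]
    unfolding partial_fractions[OF assms] recip_poch_Suc_shift[OF assms] appell_sum_def rogers_fine_sum_def sum_distrib_left
    by (simp add: ac_simps)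
  also have "cong_upto (q ^ Suc N) \<dots> (recip (1 - z) * (\<Sum>k\<le>N. rogers_fine_term z k * (1 - q ^ (2 * k + 1))))"
    by (intro cong_upto_mult cong_upto_refl rogers_fine)
  finally show ?thesis by (simp add: sum_distrib_left mult.assoc)
qed

text \<open>
  The factor \<open>z - q\<close> kills all Rogers-Fine terms but the first.
\<close>
lemma appell_sum_q: "cong_upto (q ^ Suc N) (appell_sum N q) 1"
proof -
  have C0: "rogers_fine_term z 0 = 1" for z by (simp add: rogers_fine_term_def pent_def)
  have "rogers_fine_term q (Suc k) = 0" for k by (simp add: rogers_fine_term_def prod.lessThan_Suc_shift del: prod.lessThan_Suc)
  then have "rogers_fine_term q k = (if k = 0 then 1 else 0)" for k by (cases k) (simp_all add: C0)
  then have "(\<Sum>k\<le>N. recip (1 - q) * rogers_fine_term q k * (1 - q ^ (2 * k + 1)))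
      = (\<Sum>k\<le>N. if k = 0 then recip (1 - q) * (1 - q) else 0)"
    by (intro sum.cong) auto
  then show ?thesis
    using appell_sum_upto[of q N] q0 mult_recip[of "1 - q"] by (simp add: mult.commute)
qed

text \<open>
  The products cancel except for \<open>2 / ((1 + q\<^sup>k) (1 + q\<^sup>k\<^sup>+\<^sup>1))\<close>, and
  \<open>1 - q\<^sup>2\<^sup>k\<^sup>+\<^sup>1 = (1 + q\<^sup>k\<^sup>+\<^sup>1) - q\<^sup>k\<^sup>+\<^sup>1 (1 +
  q\<^sup>k)\<close> splits each term so that the sum telescopes up to pentagonal powers. The result is a false
  theta function: the pentagonal series with different signs.
\<close>
lemma appell_sum_minus_q:
  "cong_upto (q ^ Suc N) (appell_sum N (- q)) (2 * (\<Sum>k\<le>N. q ^ pent k - q ^ (pent k + 2 * k + 1)) - 1)"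
proof -
  define e where "e k = recip (1 + q ^ k)" for k
  define t where "t k = recip (1 - (- q)) * rogers_fine_term (- q) k * (1 - q ^ (2 * k + 1))" for k
  have e: "q ^ k * e k = 1 - e k" if "k > 0" for k
  proof -
    have "fps_nth (q ^ k) 0 = 0" using that q0 by (cases k) simp_all
    then have "(1 + q ^ k) * e k = 1" unfolding e_def by (intro mult_recip) simp
    then show ?thesis by (simp add: algebra_simps)
  qed
  have t0: "t 0 = 1 - 2 * q * e 1"
    using e[of 1] by (simp add: t_def rogers_fine_term_def pent_def e_def algebra_simps)
  have t: "t k = 2 * q ^ (pent k + k) * (e k - q ^ Suc k * e (Suc k))" if k: "k = Suc j" for k j
  proof -
    have c: "(\<Prod>i<k. - q - q ^ Suc i) = (- q) ^ k * (2 * poch q (- q) j)"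
    proof -
      have "(\<Prod>i<k. - q - q ^ Suc i) = (\<Prod>i<k. - q * (1 + q ^ i))"
        by (rule prod.cong) (simp_all add: algebra_simps)
      also have "\<dots> = (- q) ^ k * (\<Prod>i<k. 1 + q ^ i)"
        unfolding prod.distrib by simp
      also have "(\<Prod>i<k. 1 + q ^ i) = 2 * poch q (- q) j"
        unfolding k prod.lessThan_Suc_shift by (simp add: poch_def)
      finally show ?thesis .
    qed
    have r: "recip (1 - (- q)) * recip (poch q (- q * q) k) = recip (poch q (- q) j) * (e k * e (Suc k))"
    proof -
      have "recip (1 - (- q)) * recip (poch q (- q * q) k) = recip (poch q (- q) (Suc k))"
        using recip_poch_Suc_shift[of "- q" k] q0 by simp
      also have "poch q (- q) (Suc k) = poch q (- q) j * ((1 + q ^ k) * (1 + q ^ Suc k))"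
        by (simp add: k poch_Suc mult.assoc)
      finally show ?thesis
        using q0 k by (simp add: recip_mult poch_nth_0 e_def)
    qed
    have u: "poch q (- q) j * recip (poch q (- q) j) = 1"
      by (rule mult_recip[OF poch_nth_0]) (simp add: q0)
    have s: "(- 1) ^ k * (- q) ^ k = q ^ k"
      by (simp flip: power_mult_distrib)
    have "t k = ((- 1) ^ k * (- q) ^ k) * q ^ pent k * 2 * (poch q (- q) j * recip (poch q (- q) j))
        * (e k * e (Suc k)) * (1 - q ^ (2 * k + 1))"
      unfolding t_def rogers_fine_term_def c using r by (simp only: ac_simps)
    also have "\<dots> = 2 * q ^ (pent k + k) * (e k * e (Suc k) * (1 - q ^ (2 * k + 1)))"
      unfolding u s by (simp add: power_add ac_simps)
    also have "e k * e (Suc k) * (1 - q ^ (2 * k + 1)) = e k - q ^ Suc k * e (Suc k)"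
    proof -
      have "e k * e (Suc k) * (1 - q ^ (2 * k + 1))
          = e k * (e (Suc k) + q ^ Suc k * e (Suc k)) - q ^ Suc k * e (Suc k) * (e k + q ^ k * e k)"
        by (simp add: algebra_simps power_add mult_2 mult_2_right)
      then show ?thesis using e[of k] e[of "Suc k"] k by (simp del: power_Suc)
    qed
    finally show ?thesis .
  qed
  have "(\<Sum>k\<le>N. t k) = 2 * q ^ pent (Suc N) * e (Suc N)
      + (2 * (\<Sum>k\<le>N. q ^ pent k - q ^ (pent k + 2 * k + 1)) - 1)"
  proof (induction N)
    case 0
    have q1: "q * e 1 = 1 - e 1" using e[of 1] by simp
    have q2: "q * (q * e 1) = q - 1 + e 1"
      by (simp only: q1 right_diff_distrib) simp
    have h1: "2 * q ^ pent (Suc 0) * e (Suc 0) = 2 * (q - 1 + e 1)"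
      unfolding q2[symmetric] by (simp add: pent_Suc power2_eq_square)
    have h2: "t 0 = 2 * e 1 - 1"
      unfolding t0 mult.assoc q1 by simp
    show ?case by (simp add: h1 h2)
  next
    case (Suc N)
    define k where "k = Suc N"
    define p a where "p = q ^ pent k" and "a = q ^ k"
    have pw: "q ^ (pent k + k) = p * a" "q ^ (pent k + 2 * k + 1) = p * (a * (a * q))"
      "q ^ Suc k = a * q" "q ^ pent (Suc k) = p * (a * (a * q)) * (a * q)"
      by (simp_all add: p_def a_def pent_Suc power_add mult_2 numeral_3_eq_3 mult_2_right
            power_mult power2_eq_square power3_eq_cube ac_simps)
    have ek: "a * e k = 1 - e k" "a * q * e (Suc k) = 1 - e (Suc k)"
      using e[of k] e[of "Suc k"] by (simp_all add: k_def a_def mult.commute mult.left_commute)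
    have "t k = 2 * p * (a * e k) - 2 * (p * (a * (a * q))) * e (Suc k)"
      unfolding t[OF k_def] pw by (simp only: right_diff_distrib) (simp only: ac_simps)
    also have "\<dots> = 2 * p * (1 - e k) - 2 * (p * (a * (a * q))) * (1 - a * q * e (Suc k))"
      by (simp only: ek) simp
    also have "\<dots> = 2 * (p - p * (a * (a * q))) + 2 * (p * (a * (a * q)) * (a * q)) * e (Suc k) - 2 * p * e k"
      by (simp only: algebra_simps mult_1_left mult_1_right)
    finally have tk: "t k = 2 * (p - p * (a * (a * q))) + 2 * q ^ pent (Suc k) * e (Suc k) - 2 * p * e k"
      unfolding pw(4) .
    show ?case
      unfolding sum.atMost_Suc Suc.IH
      unfolding k_def[symmetric] pw(2) p_def[symmetric] tk
      by (simp add: algebra_simps)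
  qed
  moreover have "cong_upto (q ^ Suc N) (appell_sum N (- q)) (\<Sum>k\<le>N. t k)"
    unfolding t_def by (rule appell_sum_upto) (simp add: q0)
  moreover have "q ^ Suc N dvd 2 * q ^ pent (Suc N) * e (Suc N)"
    by (intro dvd_mult dvd_mult2 le_imp_power_dvd) (simp add: pent_Suc)
  ultimately show ?thesis using cong_upto_trans[OF _ cong_upto_zero] by simp
qed

text \<open>
  For \<open>z\<^sup>2 = q\<close> the factors \<open>z - q\<^sup>i\<close> of the numerator are \<open>z (1 - z
  q\<^sup>i\<^sup>-\<^sup>1)\<close>, so they cancel against the denominator, and the one factor left over divides
  \<open>1 - q\<^sup>2\<^sup>k\<^sup>+\<^sup>1\<close>.
\<close>
lemma appell_sum_sqrt_q:
  assumes "z\<^sup>2 = q" "fps_nth z 0 = 0"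
  shows "cong_upto (q ^ Suc N) (appell_sum N z) (\<Sum>k\<le>N. (- 1) ^ k * q ^ pent k * z ^ k * (1 + z ^ (2 * k + 1)))"
proof -
  have "recip (1 - z) * rogers_fine_term z k * (1 - q ^ (2 * k + 1))
      = (- 1) ^ k * q ^ pent k * z ^ k * (1 + z ^ (2 * k + 1))" for k
  proof -
    have zq: "z * q ^ k = z ^ (2 * k + 1)" for k
      using assms(1) by (simp add: power_mult)
    have c: "(\<Prod>i<k. z - q ^ Suc i) = z ^ k * poch q z k"
    proof -
      have "(\<Prod>i<k. z - q ^ Suc i) = (\<Prod>i<k. z * (1 - z * q ^ i))"
        using assms(1) by (intro prod.cong) (auto simp: algebra_simps power2_eq_square)
      then show ?thesis by (simp add: prod.distrib poch_def)
    qed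
    have u: "poch q z (Suc k) * recip (poch q z (Suc k)) = 1"
      by (rule mult_recip[OF poch_nth_0[OF assms(2)]])
    have "1 - q ^ (2 * k + 1) = (1 - z * q ^ k) * (1 + z ^ (2 * k + 1))"
    proof -
      have "q ^ (2 * k + 1) = z ^ (2 * k + 1) * z ^ (2 * k + 1)"
        unfolding assms(1)[symmetric] power_mult[symmetric] power_add[symmetric] by (simp add: mult_2)
      then show ?thesis unfolding zq by (simp add: algebra_simps)
    qed
    then have "recip (1 - z) * rogers_fine_term z k * (1 - q ^ (2 * k + 1))
      = (- 1) ^ k * q ^ pent k * z ^ k * (poch q z (Suc k) * (recip (1 - z) * recip (poch q (z * q) k)))
          * (1 + z ^ (2 * k + 1))"
      unfolding rogers_fine_term_def c poch_Suc[of q z k] by (simp only: ac_simps)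
    then show ?thesis unfolding recip_poch_Suc_shift[OF assms(2), symmetric] u by simp
  qed
  then show ?thesis using appell_sum_upto[OF assms(2), of N] by simp
qed

end

section \<open>Gauss's triangular series\<close>

lemma qfac_square:
  assumes "fps_nth q 0 = 0"
  shows "qfac q n * poch q (- q) n = qfac (q\<^sup>2) (n :: nat)"
proof -
  have sq: "fps_nth (q\<^sup>2) 0 = 0" using assms by (simp add: power2_eq_square)
  show ?thesis
  proof (induction n)
    case (Suc n)
    have "qfac q (Suc n) * poch q (- q) (Suc n)
        = (qfac q n * poch q (- q) n) * ((1 - q ^ Suc n) * (1 + q ^ Suc n))"
      by (simp add: qfac_Suc[OF assms] poch_Suc ac_simps)
    also have "(1 - q ^ Suc n) * (1 + q ^ Suc n) = 1 - (q\<^sup>2) ^ Suc n"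
      unfolding power_mult[symmetric] mult_2 power_add by (simp add: algebra_simps)
    finally show ?case unfolding Suc qfac_Suc[OF sq] .
  qed (simp add: qfac_0[OF assms] qfac_0[OF sq])
qed

text \<open>
  The \<open>q\<close>-binomial theorem for \<open>\<Prod>\<^sub>j (q\<^sup>N + q\<^sup>j)\<close> over \<open>j <
  2 N + 1\<close>, a finite form of the triple product. The summands at \<open>N - i\<close> and \<open>N + 1 +
  i\<close> coincide, which produces a factor \<open>2\<close>; the other side has the same factor from \<open>j =
  N\<close>.
\<close>
lemma gauss_finite:
  fixes q :: "int fps"
  assumes q0: "fps_nth q 0 = 0" and "q \<noteq> 0"
  shows "qfac q (2 * N + 1) * (\<Sum>i\<le>N. q ^ (Suc i choose 2) * recip_pair q (2 * N + 1) (N - i))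
       = poch q (- q) N ^ 2"
proof -
  define n where "n = 2 * N + 1"
  define e where "e = (N choose 2) + N * N + N"
  define f where "f m = q ^ (m choose 2) * (q ^ N) ^ (n - m) * recip_pair q n m" for m
  define D where "D = poch q (- q) N"
  have two: "(k choose 2) * 2 + k = k * k" for k :: nat
    by (induction k) (simp_all add: choose_two_Suc)
  have ex: "q ^ (m choose 2) * (q ^ N) ^ (n - m) = q ^ e * q ^ (Suc i choose 2)"
    if "m = N - i \<or> m = N + 1 + i" "i \<le> N" for i m
  proof -
    obtain j where j: "N = i + j" using \<open>i \<le> N\<close> le_Suc_ex by blast
    have "(m choose 2) + N * (n - m) = e + (Suc i choose 2)"
      using that(1) two[of m] two[of N] two[of i] two[of j]
      by (auto simp: n_def e_def choose_two_Suc j algebra_simps)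
    then show ?thesis by (simp flip: power_mult power_add)
  qed
  have f1: "f (N - i) = q ^ e * (q ^ (Suc i choose 2) * recip_pair q n (N - i))" if "i \<le> N" for i
    unfolding f_def using ex[of "N - i" i] that by simp
  have f2: "f (Suc (N + i)) = q ^ e * (q ^ (Suc i choose 2) * recip_pair q n (N - i))" if "i \<le> N" for i
  proof -
    have "recip_pair q n (N + 1 + i) = recip_pair q n (N - i)"
      using that by (simp add: recip_pair_def[OF q0] n_def mult.commute)
    then show ?thesis unfolding f_def using ex[of "N + 1 + i" i] that by simp
  qed
  have s1: "(\<Sum>i\<le>N. f (N - i)) = q ^ e * (\<Sum>i\<le>N. q ^ (Suc i choose 2) * recip_pair q n (N - i))"
    unfolding sum_distrib_left by (rule sum.cong) (simp_all add: f1)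
  have s2: "(\<Sum>i\<le>N. f (Suc (N + i))) = q ^ e * (\<Sum>i\<le>N. q ^ (Suc i choose 2) * recip_pair q n (N - i))"
    unfolding sum_distrib_left by (rule sum.cong) (simp_all add: f2)
  have "altsum q n (\<lambda>m. (- 1) ^ m * (q ^ N) ^ (n - m)) = (\<Sum>m\<le>n. f m)"
    unfolding altsum_def[OF q0] f_def
  proof (rule sum.cong)
    fix m
    have "(- 1) ^ m * q ^ (m choose 2) * recip_pair q n m * ((- 1) ^ m * (q ^ N) ^ (n - m))
        = ((- 1) ^ m * (- 1) ^ m) * (q ^ (m choose 2) * (q ^ N) ^ (n - m) * recip_pair q n m)"
      by (simp only: ac_simps)
    then show "(- 1) ^ m * q ^ (m choose 2) * recip_pair q n m * ((- 1) ^ m * (q ^ N) ^ (n - m))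
        = q ^ (m choose 2) * (q ^ N) ^ (n - m) * recip_pair q n m"
      by (simp flip: power_mult_distrib)
  qed simp
  also have "\<dots> = (\<Sum>m\<le>N. f m) + (\<Sum>m=N+1..n. f m)"
  proof -
    have "{..n} = {..N} \<union> {N+1..n}" by (auto simp: n_def)
    then show ?thesis by (simp add: sum.union_disjoint disjoint_iff)
  qed
  also have "(\<Sum>m\<le>N. f m) = (\<Sum>i\<le>N. f (N - i))"
    by (rule sum.reindex_bij_witness[of _ "\<lambda>i. N - i" "\<lambda>i. N - i"]) auto
  also have "(\<Sum>m=N+1..n. f m) = (\<Sum>i\<le>N. f (N + 1 + i))"
    by (rule sum.reindex_bij_witness[of _ "\<lambda>i. N + 1 + i" "\<lambda>m. m - (N + 1)"]) (auto simp: n_def)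
  finally have "altsum q n (\<lambda>m. (- 1) ^ m * (q ^ N) ^ (n - m))
      = 2 * q ^ e * (\<Sum>i\<le>N. q ^ (Suc i choose 2) * recip_pair q n (N - i))"
    by (simp add: s1 s2)
  then have "2 * q ^ e * (qfac q n * (\<Sum>i\<le>N. q ^ (Suc i choose 2) * recip_pair q n (N - i)))
      = (\<Prod>j<n. q ^ N + q ^ j)"
    using q_binomial[OF q0, of n "- 1" "q ^ N"] by (simp add: mult.left_commute)
  also have "\<dots> = (\<Prod>j<N. q ^ N + q ^ j) * (2 * q ^ N) * (\<Prod>j<N. q ^ N + q ^ (N + 1 + j))"
  proof -
    have n: "n = Suc N + N" by (simp add: n_def)
    have "(\<Prod>j<a + b. h j) = (\<Prod>j<a. h j) * (\<Prod>j<b. h (a + j))" for a b and h :: "nat \<Rightarrow> int fps"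
      by (induction b) (simp_all add: mult.assoc)
    then show ?thesis unfolding n by (simp only: prod.lessThan_Suc) simp
  qed
  also have "(\<Prod>j<N. q ^ N + q ^ j) = q ^ (N choose 2) * D"
  proof -
    have "(\<Prod>j<N. q ^ N + q ^ j) = (\<Prod>j<N. q ^ j * (1 + q ^ (N - j)))"
      by (rule prod.cong) (simp_all add: algebra_simps flip: power_add)
    also have "\<dots> = (\<Prod>j<N. q ^ j) * (\<Prod>j<N. 1 + q ^ (N - j))"
      by (rule prod.distrib)
    also have "(\<Prod>j<N. q ^ j) = q ^ (N choose 2)"
      by (induction N) (simp_all add: choose_two_Suc power_add)
    also have "(\<Prod>j<N. 1 + q ^ (N - j)) = (\<Prod>j<N. 1 + q ^ Suc j)"
      by (subst prod.nat_diff_reindex[symmetric]) (auto intro!: prod.cong simp: Suc_diff_Suc simp del: power_Suc)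
    also have "\<dots> = D" by (simp add: D_def poch_def)
    finally show ?thesis .
  qed
  also have "(\<Prod>j<N. q ^ N + q ^ (N + 1 + j)) = q ^ (N * N) * D"
  proof -
    have "(\<Prod>j<N. q ^ N + q ^ (N + 1 + j)) = (\<Prod>j<N. q ^ N * (1 + q * q ^ j))"
      by (rule prod.cong) (simp_all add: algebra_simps power_add)
    then show ?thesis by (simp add: prod.distrib D_def poch_def power_mult)
  qed
  also have "q ^ (N choose 2) * D * (2 * q ^ N) * (q ^ (N * N) * D) = 2 * q ^ e * D\<^sup>2"
    by (simp add: e_def power_add power2_eq_square ac_simps)
  finally show ?thesis using \<open>q \<noteq> 0\<close> by (simp add: n_def D_def)
qed

text \<open>
  Gauss's evaluation of the series over triangular exponents, in the form \<open>(q)\<^sub>\<infinity> \<Sum>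
  q\<^bsup>i (i + 1) / 2\<^esup> = (q\<^sup>2; q\<^sup>2)\<^sub>\<infinity>\<^sup>2\<close>.
\<close>
lemma gauss_upto:
  fixes q :: "int fps"
  assumes q0: "fps_nth q 0 = 0" and "q \<noteq> 0"
  shows "cong_upto (q ^ Suc N) (qfac q N * (\<Sum>i\<le>N. q ^ (Suc i choose 2))) (qfac (q\<^sup>2) N ^ 2)"
proof -
  let ?n = "2 * N + 1"
  let ?c = "\<lambda>i. (qfac q N * recip (qfac q (N - i))) * (qfac q ?n * recip (qfac q (N + 1 + i)))"
  have c: "cong_upto (q ^ Suc (N - i)) (?c i) (1 * 1)" if "i \<le> N" for i
    by (intro cong_upto_mult cong_upto_qfac_ratio[OF q0]
        cong_upto_dvd[OF cong_upto_qfac_ratio[OF q0], of "N + 1 + i"] le_imp_power_dvd) (use that in auto)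
  have "qfac (q\<^sup>2) N ^ 2 = qfac q N ^ 2 * poch q (- q) N ^ 2"
    by (simp add: qfac_square[OF q0, symmetric] power_mult_distrib)
  also have "\<dots> = (\<Sum>i\<le>N. qfac q N * q ^ (Suc i choose 2) * ?c i)"
    unfolding gauss_finite[OF assms, symmetric] sum_distrib_left
    by (rule sum.cong) (simp_all add: recip_pair_def[OF q0] power2_eq_square ac_simps)
  also have "cong_upto (q ^ Suc N) \<dots> (\<Sum>i\<le>N. qfac q N * q ^ (Suc i choose 2) * (1 * 1))"
  proof (rule cong_upto_sum)
    fix i assume i: "i \<in> {..N}"
    have "q ^ i dvd qfac q N * q ^ (Suc i choose 2)"
      by (intro dvd_mult le_imp_power_dvd le_choose_two_Suc)
    with i show "cong_upto (q ^ Suc N) (qfac q N * q ^ (Suc i choose 2) * ?c i)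
        (qfac q N * q ^ (Suc i choose 2) * (1 * 1))"
      by (intro cong_upto_scale[where e = "Suc (N - i)" and k = i] c) auto
  qed
  finally show ?thesis by (simp add: cong_upto_sym sum_distrib_left)
qed

section \<open>Generating functions of concave compositions\<close>

definition gf :: "'s set \<Rightarrow> ('s \<Rightarrow> nat) \<Rightarrow> int fps" where
  "gf A w = Abs_fps (\<lambda>n. int (card {a \<in> A. w a = n}))"

text \<open>
  Without this condition \<open>gf\<close> records the cardinality \<open>0\<close> for infinite fibres.
\<close>
definition finite_fibres :: "'s set \<Rightarrow> ('s \<Rightarrow> nat) \<Rightarrow> bool" where
  "finite_fibres A w \<longleftrightarrow> (\<forall>n. finite {a \<in> A. w a = n})"

lemma gf_bij:
  assumes "bij_betw f A B" "\<And>a. a \<in> A \<Longrightarrow> v (f a) = k + w a"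
  shows "gf B v = fps_X ^ k * gf A w"
proof (rule fps_ext)
  fix n
  show "fps_nth (gf B v) n = fps_nth (fps_X ^ k * gf A w) n"
  proof (cases "n < k")
    case True
    have "{b \<in> B. v b = n} = {}"
      using assms True by (auto simp: bij_betw_def)
    then show ?thesis using True unfolding gf_def by (simp only: fps_X_power_mult_nth fps_nth_Abs_fps) simp
  next
    case False
    have "bij_betw f {a \<in> A. w a = n - k} {b \<in> B. v b = n}"
      using assms False by (auto simp: bij_betw_def inj_on_def)
    then show ?thesis using False by (simp add: gf_def fps_X_power_mult_nth bij_betw_same_card)
  qed
qed

lemma gf_Un:
  assumes "finite_fibres A w" "finite_fibres B w" "A \<inter> B = {}"
  shows "gf (A \<union> B) w = gf A w + gf B w"
proof (rule fps_ext)
  fix n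
  have "{a \<in> A \<union> B. w a = n} = {a \<in> A. w a = n} \<union> {a \<in> B. w a = n}" by auto
  moreover have "card ({a \<in> A. w a = n} \<union> {a \<in> B. w a = n}) = card {a \<in> A. w a = n} + card {a \<in> B. w a = n}"
    using assms by (intro card_Un_disjoint) (auto simp: finite_fibres_def)
  ultimately show "fps_nth (gf (A \<union> B) w) n = fps_nth (gf A w + gf B w) n"
    by (simp only: gf_def fps_nth_Abs_fps fps_add_nth of_nat_add)
qed

lemma gf_Times:
  assumes "finite_fibres A w" "finite_fibres B v"
  shows "gf (A \<times> B) (\<lambda>(a, b). w a + v b) = gf A w * gf B v"
proof (rule fps_ext)
  fix n
  let ?F = "\<lambda>i. {a \<in> A. w a = i} \<times> {b \<in> B. v b = n - i}"
  have "{p \<in> A \<times> B. (\<lambda>(a, b). w a + v b) p = n} = (\<Union>i\<in>{0..n}. ?F i)" by auto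
  moreover have "card (\<Union>i\<in>{0..n}. ?F i) = (\<Sum>i\<in>{0..n}. card (?F i))"
    using assms by (intro card_UN_disjoint) (auto simp: finite_fibres_def)
  ultimately show "fps_nth (gf (A \<times> B) (\<lambda>(a, b). w a + v b)) n = fps_nth (gf A w * gf B v) n"
    by (simp add: gf_def fps_mult_nth card_cartesian_product)
qed

text \<open>
  Compositions are counted in powers of \<open>X\<^sup>2\<close>, since the identities for odd length use both
  square roots \<open>X\<close> and \<open>- X\<close> of \<open>q\<close>. The weights \<open>wt\<close> and
  \<open>wt2\<close> are therefore twice the sum.
\<close>
abbreviation Q :: "int fps" where "Q \<equiv> fps_X ^ 2"

lemma Q_nth_0: "fps_nth Q 0 = 0" by simp

definition wt :: "nat list \<Rightarrow> nat" where "wt xs = 2 * sum_list xs"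

definition wt2 :: "nat list \<times> nat list \<Rightarrow> nat" where "wt2 = (\<lambda>(as, bs). wt as + wt bs)"

definition decr :: "nat \<Rightarrow> nat list set" where
  "decr m = {xs. length xs = m \<and> sorted_wrt (>) xs}"

lemma wt_map_Suc: "wt (map Suc xs) = 2 * length xs + wt xs"
  by (induction xs) (simp_all add: wt_def)

lemma wt_append_zero: "wt (xs @ [0]) = wt xs"
  by (simp add: wt_def)

lemma positive_eq_map_Suc: "0 \<notin> set xs \<longleftrightarrow> (\<exists>ys. xs = map Suc ys)"
proof
  assume "0 \<notin> set xs"
  then have "map Suc (map (\<lambda>x. x - 1) xs) = xs"
    by (induction xs) auto
  then show "\<exists>ys. xs = map Suc ys" by metis
qed auto

lemma decreasing_map_Suc: "sorted_wrt (>) (map Suc xs) \<longleftrightarrow> sorted_wrt (>) xs"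
  by (simp add: sorted_wrt_map)

lemma decreasing_zero_iff:
  "sorted_wrt (>) xs \<and> 0 \<in> set xs \<longleftrightarrow> (\<exists>ys. xs = map Suc ys @ [0] \<and> sorted_wrt (>) ys)"
proof (cases xs rule: rev_cases)
  case (snoc zs z)
  show ?thesis
  proof
    assume *: "sorted_wrt (>) xs \<and> 0 \<in> set xs"
    then have "z = 0" "0 \<notin> set zs" by (auto simp: snoc sorted_wrt_append)
    moreover from this obtain ys where "zs = map Suc ys" using positive_eq_map_Suc by blast
    ultimately show "\<exists>ys. xs = map Suc ys @ [0] \<and> sorted_wrt (>) ys"
      using * by (auto simp: snoc sorted_wrt_append decreasing_map_Suc)
  next
    assume "\<exists>ys. xs = map Suc ys @ [0] \<and> sorted_wrt (>) ys"
    then show "sorted_wrt (>) xs \<and> 0 \<in> set xs"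
      by (auto simp: sorted_wrt_append decreasing_map_Suc)
  qed
qed simp

lemma decreasing_last_zero_iff:
  "sorted_wrt (>) xs \<Longrightarrow> xs \<noteq> [] \<Longrightarrow> 0 \<in> set xs \<longleftrightarrow> last xs = (0::nat)"
  by (cases xs rule: rev_cases) (auto simp: sorted_wrt_append)

lemma finite_fibres_wt2:
  assumes "\<And>as bs. (as, bs) \<in> T \<Longrightarrow> sorted_wrt (>) as \<and> sorted_wrt (>) bs"
  shows "finite_fibres T wt2"
  unfolding finite_fibres_def
proof
  fix n
  have "{p \<in> T. wt2 p = n} \<subseteq> {(as, bs). sorted_wrt (>) as \<and> sorted_wrt (>) bs
      \<and> sum_list as + sum_list bs = n div 2}"
    using assms by (auto simp: wt2_def wt_def)
  then show "finite {p \<in> T. wt2 p = n}"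
    using finite_decreasing_pairs finite_subset by blast
qed

lemma finite_fibres_decr: "finite_fibres (decr m) wt"
  unfolding finite_fibres_def
proof
  fix n
  have "(\<lambda>xs. (xs, [])) ` {xs \<in> decr m. wt xs = n} \<subseteq>
      {(as, bs). sorted_wrt (>) as \<and> sorted_wrt (>) bs \<and> sum_list as + sum_list bs = n div 2}"
    by (auto simp: decr_def wt_def)
  then have "finite ((\<lambda>xs. (xs, [] :: nat list)) ` {xs \<in> decr m. wt xs = n})"
    using finite_decreasing_pairs finite_subset by blast
  then show "finite {xs \<in> decr m. wt xs = n}"
    by (rule finite_imageD) (simp add: inj_on_def)
qed

text \<open>
  A configuration in which \<open>0\<close> does not occur arises from a unique configuration of the same shape by
  raising all \<open>k + l\<close> parts by one.
\<close>
lemma shift_recurrence: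
  assumes dec: "\<And>as bs. (as, bs) \<in> T \<Longrightarrow> sorted_wrt (>) as \<and> sorted_wrt (>) bs"
    and len: "\<And>as bs. (as, bs) \<in> T \<Longrightarrow> length as = k \<and> length bs = l"
    and shift: "\<And>as bs. (map Suc as, map Suc bs) \<in> T \<longleftrightarrow> (as, bs) \<in> T"
    and pos: "\<And>as bs. (as, bs) \<in> T \<Longrightarrow> 0 \<notin> set as \<Longrightarrow> 0 \<notin> set bs"
  shows "(1 - Q ^ (k + l)) * gf T wt2 = gf {(as, bs) \<in> T. 0 \<in> set as} wt2"
proof -
  let ?Z = "{(as, bs) \<in> T. 0 \<in> set as}" and ?U = "{(as, bs) \<in> T. 0 \<notin> set as}"
  have "gf T wt2 = gf (?Z \<union> ?U) wt2" by (rule arg_cong[of _ _ "\<lambda>A. gf A wt2"]) auto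
  also have "\<dots> = gf ?Z wt2 + gf ?U wt2"
    by (intro gf_Un finite_fibres_wt2) (use dec in blast)+
  also have "gf ?U wt2 = fps_X ^ (2 * (k + l)) * gf T wt2"
  proof (rule gf_bij)
    show "bij_betw (\<lambda>(as, bs). (map Suc as, map Suc bs)) T ?U"
    proof (rule bij_betw_imageI)
      show "inj_on (\<lambda>(as, bs). (map Suc as, map Suc bs)) T"
        by (auto simp: inj_on_def inj_map_eq_map)
      show "(\<lambda>(as, bs). (map Suc as, map Suc bs)) ` T = ?U"
      proof (intro equalityI subsetI)
        fix p assume "p \<in> ?U"
        then obtain as bs where p: "p = (as, bs)" "(as, bs) \<in> T" "0 \<notin> set as" by auto
        then have "0 \<notin> set bs" using pos by blast
        then obtain bs' where "bs = map Suc bs'" using positive_eq_map_Suc by blast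
        moreover obtain as' where "as = map Suc as'" using p(3) positive_eq_map_Suc by blast
        ultimately show "p \<in> (\<lambda>(as, bs). (map Suc as, map Suc bs)) ` T"
          using p shift by (intro image_eqI[of _ _ "(as', bs')"]) auto
      next
        fix p assume "p \<in> (\<lambda>(as, bs). (map Suc as, map Suc bs)) ` T"
        then show "p \<in> ?U" using shift by force
      qed
    qed
    fix p assume "p \<in> T"
    then show "wt2 (case p of (as, bs) \<Rightarrow> (map Suc as, map Suc bs)) = 2 * (k + l) + wt2 p"
      using len by (cases p) (auto simp: wt2_def wt_map_Suc)
  qed
  finally show ?thesis
    unfolding power_mult left_diff_distrib mult_1_left diff_eq_eq .
qed

lemma gf_decr: "gf (decr m) wt = Q ^ (m choose 2) * recip (qfac Q m)"
proof (induction m)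
  case 0
  have "{xs \<in> decr 0. wt xs = n} = (if n = 0 then {[]} else {})" for n
    by (auto simp: decr_def wt_def)
  then have "gf (decr 0) wt = 1"
    by (intro fps_ext) (simp add: gf_def)
  then show ?case by (simp add: qfac_0)
next
  case (Suc m)
  let ?T = "{(xs, ys). xs \<in> decr (Suc m) \<and> ys = ([] :: nat list)}"
  have 1: "gf ?T wt2 = fps_X ^ 0 * gf (decr (Suc m)) wt"
  proof (rule gf_bij[where f = "\<lambda>xs. (xs, [])"])
    show "bij_betw (\<lambda>xs. (xs, [])) (decr (Suc m)) ?T"
      by (rule bij_betwI[where g = fst]) auto
  qed (simp add: wt2_def wt_def)
  have 2: "gf {(as, bs) \<in> ?T. 0 \<in> set as} wt2 = fps_X ^ (2 * m) * gf (decr m) wt"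
  proof (rule gf_bij[where f = "\<lambda>xs. (map Suc xs @ [0], [])"])
    show "bij_betw (\<lambda>xs. (map Suc xs @ [0], [])) (decr m) {(as, bs) \<in> ?T. 0 \<in> set as}"
    proof (rule bij_betw_imageI)
      have "xs \<in> decr (Suc m) \<and> 0 \<in> set xs
          \<longleftrightarrow> length xs = Suc m \<and> (\<exists>ys. xs = map Suc ys @ [0] \<and> sorted_wrt (>) ys)" for xs
        unfolding decreasing_zero_iff[of xs, symmetric] by (auto simp: decr_def)
      also have "\<dots> xs \<longleftrightarrow> (\<exists>ys. ys \<in> decr m \<and> xs = map Suc ys @ [0])" for xs
        by (auto simp: decr_def)
      finally show "(\<lambda>xs. (map Suc xs @ [0], [])) ` decr m = {(as, bs) \<in> ?T. 0 \<in> set as}"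
        by blast
    qed (auto simp: inj_on_def inj_map_eq_map)
  qed (auto simp: wt2_def wt_append_zero wt_map_Suc decr_def wt_def[of "[]"])
  have "(1 - Q ^ (Suc m + 0)) * gf ?T wt2 = gf {(as, bs) \<in> ?T. 0 \<in> set as} wt2"
    by (rule shift_recurrence) (auto simp: decr_def decreasing_map_Suc)
  then have "(1 - Q ^ Suc m) * gf (decr (Suc m)) wt = Q ^ m * (Q ^ (m choose 2) * recip (qfac Q m))"
    unfolding 1 2 Suc by (simp add: power_mult)
  also have "\<dots> = (1 - Q ^ Suc m) * (Q ^ (Suc m choose 2) * recip (qfac Q (Suc m)))"
    unfolding recip_qfac_Suc[OF Q_nth_0, of m, symmetric] by (simp add: choose_two_Suc power_add ac_simps)
  finally show ?case by (rule mult_unit_cancel[rotated]) simp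
qed

text \<open>
  The concave compositions whose left half has \<open>m + 1\<close> parts, so that the innermost part has
  \<open>m\<close> parts to its left.
\<close>
definition even_shape :: "nat \<Rightarrow> (nat list \<times> nat list) set" where
  "even_shape m = {(as, bs). length as = Suc m \<and> length bs = Suc m \<and>
     sorted_wrt (>) as \<and> sorted_wrt (>) bs \<and> last as = last bs}"

definition odd1_shape :: "nat \<Rightarrow> (nat list \<times> nat list) set" where
  "odd1_shape m = {(as, bs). length as = Suc m \<and> length bs = m \<and>
     sorted_wrt (>) as \<and> sorted_wrt (>) bs \<and> (bs \<noteq> [] \<longrightarrow> last as < last bs)}"

definition odd2_shape :: "nat \<Rightarrow> (nat list \<times> nat list) set" where
  "odd2_shape m = {(as, bs). length as = Suc m \<and> length bs = m \<and>
     sorted_wrt (>) as \<and> sorted_wrt (>) bs \<and> (bs \<noteq> [] \<longrightarrow> last as \<le> last bs)}"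

text \<open>
  With innermost part \<open>0\<close> fixed, a composition is a pair of strictly decreasing lists of length
  \<open>m\<close>, possibly raised by one, which accounts for the weight \<open>2 * e\<close>. All three kinds of
  composition follow this pattern.
\<close>
lemma gf_shape:
  assumes dec: "\<And>as bs. (as, bs) \<in> T \<Longrightarrow> sorted_wrt (>) as \<and> sorted_wrt (>) bs"
    and len: "\<And>as bs. (as, bs) \<in> T \<Longrightarrow> length as = k \<and> length bs = l"
    and shift: "\<And>as bs. (map Suc as, map Suc bs) \<in> T \<longleftrightarrow> (as, bs) \<in> T"
    and pos: "\<And>as bs. (as, bs) \<in> T \<Longrightarrow> 0 \<notin> set as \<Longrightarrow> 0 \<notin> set bs"
    and core: "bij_betw f (decr m \<times> decr m) {(as, bs) \<in> T. 0 \<in> set as}"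
    and core_wt: "\<And>xs ys. length xs = m \<Longrightarrow> length ys = m \<Longrightarrow> wt2 (f (xs, ys)) = 2 * e + (wt xs + wt ys)"
    and "k + l > 0"
  shows "gf T wt2 = Q ^ (e + 2 * (m choose 2)) * recip (qfac Q m) ^ 2 * recip (1 - Q ^ (k + l))"
proof -
  have u: "fps_nth (1 - Q ^ (k + l)) 0 = 1"
    using \<open>k + l > 0\<close> by (simp flip: power_mult)
  have "(1 - Q ^ (k + l)) * gf T wt2 = gf {(as, bs) \<in> T. 0 \<in> set as} wt2"
    by (rule shift_recurrence[OF dec len shift pos])
  also have "\<dots> = fps_X ^ (2 * e) * gf (decr m \<times> decr m) (\<lambda>(xs, ys). wt xs + wt ys)"
    by (rule gf_bij[OF core]) (auto simp: decr_def core_wt)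
  also have "\<dots> = Q ^ e * (Q ^ (m choose 2) * recip (qfac Q m)) ^ 2"
    by (simp add: gf_Times finite_fibres_decr gf_decr power_mult power2_eq_square)
  also have "\<dots> = Q ^ (e + 2 * (m choose 2)) * recip (qfac Q m) ^ 2"
    unfolding power_mult_distrib power_even_eq power_add by (simp only: mult.assoc)
  also have "\<dots> = (1 - Q ^ (k + l)) * (Q ^ (e + 2 * (m choose 2)) * recip (qfac Q m) ^ 2 * recip (1 - Q ^ (k + l)))"
    using mult_recip[OF u] by (simp add: mult.left_commute[of "1 - _"])
  finally show ?thesis by (rule mult_unit_cancel[OF u])
qed

lemma square_eq_choose: "m\<^sup>2 = m + 2 * (m choose 2)"
  by (induction m) (simp_all add: choose_two_Suc power2_eq_square)

lemma gf_even_shape: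
  "gf (even_shape m) wt2 = Q ^ (m\<^sup>2 + m) * recip (qfac Q m) ^ 2 * recip (1 - Q ^ (2 * m + 2))"
proof -
  let ?f = "\<lambda>(xs, ys). (map Suc xs @ [0], map Suc ys @ [0 :: nat])"
  have "gf (even_shape m) wt2 =
      Q ^ (2 * m + 2 * (m choose 2)) * recip (qfac Q m) ^ 2 * recip (1 - Q ^ (Suc m + Suc m))"
  proof (rule gf_shape[where f = ?f])
    show "bij_betw ?f (decr m \<times> decr m) {(as, bs) \<in> even_shape m. 0 \<in> set as}"
    proof (rule bij_betw_imageI)
      show "?f ` (decr m \<times> decr m) = {(as, bs) \<in> even_shape m. 0 \<in> set as}"
      proof (intro equalityI subsetI)
        fix p assume "p \<in> {(as, bs) \<in> even_shape m. 0 \<in> set as}"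
        then obtain as bs where p: "p = (as, bs)" "(as, bs) \<in> even_shape m" "0 \<in> set as" by auto
        moreover from this have "as \<noteq> []" "bs \<noteq> []" by (auto simp: even_shape_def)
        ultimately have "0 \<in> set bs"
          using decreasing_last_zero_iff[of as] decreasing_last_zero_iff[of bs]
          by (simp add: even_shape_def)
        with p obtain xs ys where "as = map Suc xs @ [0]" "sorted_wrt (>) xs"
          "bs = map Suc ys @ [0]" "sorted_wrt (>) ys"
          using decreasing_zero_iff[of as] decreasing_zero_iff[of bs] by (auto simp: even_shape_def)
        with p show "p \<in> ?f ` (decr m \<times> decr m)"
          by (intro image_eqI[of _ _ "(xs, ys)"]) (auto simp: even_shape_def decr_def)
      qed (auto simp: even_shape_def decr_def sorted_wrt_append decreasing_map_Suc)
    qed (auto simp: inj_on_def inj_map_eq_map)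
    show "0 \<notin> set bs" if "(as, bs) \<in> even_shape m" "0 \<notin> set as" for as bs
    proof -
      have "as \<noteq> []" "bs \<noteq> []" using that by (auto simp: even_shape_def)
      then show ?thesis
        using that decreasing_last_zero_iff[of as] decreasing_last_zero_iff[of bs]
        by (simp add: even_shape_def)
    qed
    show "(map Suc as, map Suc bs) \<in> even_shape m \<longleftrightarrow> (as, bs) \<in> even_shape m" for as bs
      by (cases "as = []"; cases "bs = []") (auto simp: even_shape_def decreasing_map_Suc last_map)
  qed (auto simp: even_shape_def wt2_def wt_append_zero wt_map_Suc)
  moreover have "2 * m + 2 * (m choose 2) = m\<^sup>2 + m" by (simp add: square_eq_choose)
  moreover have "Suc m + Suc m = 2 * m + 2" by simp
  ultimately show ?thesis by (simp only:)
qed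

lemma gf_odd1_shape:
  "gf (odd1_shape m) wt2 = Q ^ (m\<^sup>2 + m) * recip (qfac Q m) ^ 2 * recip (1 - Q ^ (2 * m + 1))"
proof -
  let ?f = "\<lambda>(xs, ys). (map Suc xs @ [0], map Suc ys)"
  have "gf (odd1_shape m) wt2 =
      Q ^ (2 * m + 2 * (m choose 2)) * recip (qfac Q m) ^ 2 * recip (1 - Q ^ (Suc m + m))"
  proof (rule gf_shape[where f = ?f])
    show "bij_betw ?f (decr m \<times> decr m) {(as, bs) \<in> odd1_shape m. 0 \<in> set as}"
    proof (rule bij_betw_imageI)
      show "?f ` (decr m \<times> decr m) = {(as, bs) \<in> odd1_shape m. 0 \<in> set as}"
      proof (intro equalityI subsetI)
        fix p assume "p \<in> {(as, bs) \<in> odd1_shape m. 0 \<in> set as}"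
        then obtain as bs where p: "p = (as, bs)" "(as, bs) \<in> odd1_shape m" "0 \<in> set as" by auto
        then have "0 \<notin> set bs"
          using decreasing_last_zero_iff[of bs] by (cases "bs = []") (auto simp: odd1_shape_def)
        then obtain ys where ys: "bs = map Suc ys" using positive_eq_map_Suc by blast
        obtain xs where "as = map Suc xs @ [0]" "sorted_wrt (>) xs"
          using p decreasing_zero_iff[of as] by (auto simp: odd1_shape_def)
        with p ys show "p \<in> ?f ` (decr m \<times> decr m)"
          by (intro image_eqI[of _ _ "(xs, ys)"]) (auto simp: odd1_shape_def decr_def decreasing_map_Suc)
      next
        fix p assume "p \<in> ?f ` (decr m \<times> decr m)"
        then obtain xs ys where "p = ?f (xs, ys)" "xs \<in> decr m" "ys \<in> decr m" by auto
        then show "p \<in> {(as, bs) \<in> odd1_shape m. 0 \<in> set as}"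
          by (cases "ys = []")
            (simp_all add: odd1_shape_def decr_def sorted_wrt_append decreasing_map_Suc last_map)
      qed
    qed (auto simp: inj_on_def inj_map_eq_map)
    show "0 \<notin> set bs" if "(as, bs) \<in> odd1_shape m" "0 \<notin> set as" for as bs
      using that decreasing_last_zero_iff[of bs] by (cases "bs = []") (auto simp: odd1_shape_def)
    show "(map Suc as, map Suc bs) \<in> odd1_shape m \<longleftrightarrow> (as, bs) \<in> odd1_shape m" for as bs
      by (cases "as = []"; cases "bs = []") (auto simp: odd1_shape_def decreasing_map_Suc last_map)
  qed (auto simp: odd1_shape_def wt2_def wt_append_zero wt_map_Suc)
  moreover have "2 * m + 2 * (m choose 2) = m\<^sup>2 + m" by (simp add: square_eq_choose)
  moreover have "Suc m + m = 2 * m + 1" by simp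
  ultimately show ?thesis by (simp only:)
qed

lemma gf_odd2_shape:
  "gf (odd2_shape m) wt2 = Q ^ (m\<^sup>2) * recip (qfac Q m) ^ 2 * recip (1 - Q ^ (2 * m + 1))"
proof -
  let ?f = "\<lambda>(xs, ys). (map Suc xs @ [0], ys)"
  have "gf (odd2_shape m) wt2 =
      Q ^ (m + 2 * (m choose 2)) * recip (qfac Q m) ^ 2 * recip (1 - Q ^ (Suc m + m))"
  proof (rule gf_shape[where f = ?f])
    show "bij_betw ?f (decr m \<times> decr m) {(as, bs) \<in> odd2_shape m. 0 \<in> set as}"
    proof (rule bij_betw_imageI)
      show "?f ` (decr m \<times> decr m) = {(as, bs) \<in> odd2_shape m. 0 \<in> set as}"
      proof (intro equalityI subsetI)
        fix p assume "p \<in> {(as, bs) \<in> odd2_shape m. 0 \<in> set as}"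
        then obtain as bs where p: "p = (as, bs)" "(as, bs) \<in> odd2_shape m" "0 \<in> set as" by auto
        obtain xs where "as = map Suc xs @ [0]" "sorted_wrt (>) xs"
          using p decreasing_zero_iff[of as] by (auto simp: odd2_shape_def)
        with p show "p \<in> ?f ` (decr m \<times> decr m)"
          by (intro image_eqI[of _ _ "(xs, bs)"]) (auto simp: odd2_shape_def decr_def)
      qed (auto simp: odd2_shape_def decr_def sorted_wrt_append decreasing_map_Suc)
    qed (auto simp: inj_on_def inj_map_eq_map)
    show "0 \<notin> set bs" if "(as, bs) \<in> odd2_shape m" "0 \<notin> set as" for as bs
    proof -
      have "as \<noteq> []" using that by (auto simp: odd2_shape_def)
      then show ?thesis
        using that decreasing_last_zero_iff[of as] decreasing_last_zero_iff[of bs]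
        by (cases "bs = []") (auto simp: odd2_shape_def)
    qed
    show "(map Suc as, map Suc bs) \<in> odd2_shape m \<longleftrightarrow> (as, bs) \<in> odd2_shape m" for as bs
      by (cases "as = []"; cases "bs = []") (auto simp: odd2_shape_def decreasing_map_Suc last_map)
  qed (auto simp: odd2_shape_def wt2_def wt_append_zero wt_map_Suc)
  moreover have "m + 2 * (m choose 2) = m\<^sup>2" by (simp add: square_eq_choose)
  moreover have "Suc m + m = 2 * m + 1" by simp
  ultimately show ?thesis by (simp only:)
qed

lemma card_shapes:
  assumes T: "\<And>m as bs. (as, bs) \<in> T m \<Longrightarrow> length as = Suc m \<and> sorted_wrt (>) as \<and> sorted_wrt (>) bs"
    and "n \<le> N"
    and A: "A = {(as, bs). (\<exists>m. (as, bs) \<in> T m) \<and> sum_list as + sum_list bs = n}"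
  shows "int (card A) = fps_nth (\<Sum>m\<le>N. gf (T m) wt2) (2 * n)"
proof -
  let ?F = "\<lambda>m. {p \<in> T m. wt2 p = 2 * n}"
  have m: "m \<le> N" if "(as, bs) \<in> T m" "sum_list as + sum_list bs = n" for m as bs
    using T[OF that(1)] that(2) length_le_Suc_sum_list_decreasing[of as] \<open>n \<le> N\<close> by linarith
  have "A = (\<Union>m\<in>{..N}. ?F m)"
  proof (intro equalityI subsetI)
    fix p assume "p \<in> A"
    then obtain as bs k where p: "p = (as, bs)" "(as, bs) \<in> T k" "sum_list as + sum_list bs = n"
      unfolding A by blast
    then have "p \<in> ?F k" unfolding wt2_def wt_def by simp
    then show "p \<in> (\<Union>m\<in>{..N}. ?F m)" using m[OF p(2,3)] by blast
  next
    fix p assume "p \<in> (\<Union>m\<in>{..N}. ?F m)"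
    then obtain as bs k where "p = (as, bs)" "(as, bs) \<in> T k" "wt2 (as, bs) = 2 * n"
      by (cases p) blast
    moreover from this have "sum_list as + sum_list bs = n" unfolding wt2_def wt_def by simp
    ultimately show "p \<in> A" unfolding A by blast
  qed
  moreover have "card (\<Union>m\<in>{..N}. ?F m) = (\<Sum>m\<le>N. card (?F m))"
  proof (intro card_UN_disjoint ballI impI)
    fix k show "finite (?F k)"
      using finite_fibres_wt2[of "T k"] T unfolding finite_fibres_def by blast
  next
    fix k l :: nat assume "k \<noteq> l"
    then have "(as, bs) \<notin> T l" if "(as, bs) \<in> T k" for as bs
      using T[of as bs k] T[of as bs l] that by force
    then show "?F k \<inter> ?F l = {}" by auto
  qed simp
  ultimately show ?thesis by (simp add: fps_sum_nth gf_def)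
qed

lemma ce_eq:
  assumes "n \<le> N"
  shows "int (ce n) = fps_nth (\<Sum>m\<le>N. gf (even_shape m) wt2) (2 * n)"
  unfolding ce_def
proof (rule card_shapes[OF _ assms])
  have "length as = length bs \<and> 1 \<le> length as \<longleftrightarrow> (\<exists>m. length as = Suc m \<and> length bs = Suc m)"
    for as bs :: "nat list"
    by (cases as) auto
  then show "concave_even n = {(as, bs). (\<exists>m. (as, bs) \<in> even_shape m) \<and> sum_list as + sum_list bs = n}"
    unfolding concave_even_def even_shape_def by blast
qed (simp add: even_shape_def)

lemma co1_eq:
  assumes "n \<le> N"
  shows "int (co1 n) = fps_nth (\<Sum>m\<le>N. gf (odd1_shape m) wt2) (2 * n)"
  unfolding co1_def
  by (rule card_shapes[OF _ assms]) (auto simp: odd1_shape_def concave_odd1_def)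

lemma co2_eq:
  assumes "n \<le> N"
  shows "int (co2 n) = fps_nth (\<Sum>m\<le>N. gf (odd2_shape m) wt2) (2 * n)"
  unfolding co2_def
  by (rule card_shapes[OF _ assms]) (auto simp: odd2_shape_def concave_odd2_def)

section \<open>The generating functions times the Euler product\<close>

lemma cong_upto_nth:
  assumes "cong_upto (Q ^ Suc N) f g" "k < 2 * Suc N"
  shows "fps_nth f k = fps_nth g k"
proof -
  obtain h where "f - g = Q ^ Suc N * h" using assms(1) unfolding cong_upto_def by (rule dvdE)
  then have "fps_nth (f - g) k = fps_nth (fps_X ^ (2 * Suc N) * h) k"
    unfolding power_mult by simp
  then show ?thesis using assms(2) unfolding fps_X_power_mult_nth by simp
qed

lemma even_coefficient:
  assumes "2 dvd (f :: int fps)"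
  shows "even (fps_nth f k)"
proof -
  obtain h where h: "f = 2 * h" using assms by (rule dvdE)
  show ?thesis unfolding h numeral_fps_const fps_mult_left_const_nth by simp
qed

lemma recip_average:
  assumes "fps_nth y 0 = 0"
  shows "recip (1 - y) + recip (1 + y) = 2 * recip (1 - y\<^sup>2)"
proof (rule mult_unit_cancel)
  have sq: "fps_nth (1 - y\<^sup>2) 0 = 1" using assms by (simp add: power2_eq_square)
  show "fps_nth (1 - y\<^sup>2) 0 = 1" by (fact sq)
  have "(1 - y\<^sup>2) * (recip (1 - y) + recip (1 + y))
      = (1 + y) * ((1 - y) * recip (1 - y)) + (1 - y) * ((1 + y) * recip (1 + y))"
    by (simp add: power2_eq_square algebra_simps)
  also have "\<dots> = 2" using assms by (simp add: mult_recip)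
  also have "\<dots> = 2 * ((1 - y\<^sup>2) * recip (1 - y\<^sup>2))" by (simp add: mult_recip[OF sq])
  finally show "(1 - y\<^sup>2) * (recip (1 - y) + recip (1 + y)) = (1 - y\<^sup>2) * (2 * recip (1 - y\<^sup>2))"
    by (simp add: ac_simps)
qed

lemma recip_fixpoint:
  assumes "fps_nth y 0 = 0"
  shows "recip (1 - y) = 1 + y * recip (1 - y)"
proof -
  have "(1 - y) * recip (1 - y) = 1" by (rule mult_recip) (simp add: assms)
  then show ?thesis unfolding left_diff_distrib mult_1_left diff_eq_eq .
qed

text \<open>
  The average over both signs of \<open>z\<close> replaces \<open>z\<close> by \<open>z\<^sup>2\<close> in the
  denominators.
\<close>
lemma appell_sum_average:
  assumes "fps_nth z 0 = 0"
  shows "appell_sum Q N z + appell_sum Q N (- z)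
    = 2 * (qfac Q N * (\<Sum>m\<le>N. Q ^ (m\<^sup>2 + m) * recip (qfac Q m) ^ 2 * recip (1 - (z * Q ^ m)\<^sup>2)))"
proof -
  have "appell_sum Q N z + appell_sum Q N (- z) = qfac Q N *
      (\<Sum>m\<le>N. Q ^ (m\<^sup>2 + m) * recip (qfac Q m) ^ 2 * (recip (1 - z * Q ^ m) + recip (1 + z * Q ^ m)))"
    unfolding appell_sum_def[OF Q_nth_0] distrib_left[symmetric] sum.distrib[symmetric]
    by (rule arg_cong[of _ _ "(*) (qfac Q N)"], rule sum.cong)
      (simp_all only: power_add distrib_left mult_minus_left diff_minus_eq_add ac_simps)
  also have "\<dots> = qfac Q N *
      (\<Sum>m\<le>N. 2 * (Q ^ (m\<^sup>2 + m) * recip (qfac Q m) ^ 2 * recip (1 - (z * Q ^ m)\<^sup>2)))"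
  proof (rule arg_cong[of _ _ "(*) (qfac Q N)"], rule sum.cong)
    fix m
    have "fps_nth (z * Q ^ m) 0 = 0" using assms by simp
    from recip_average[OF this] show
      "Q ^ (m\<^sup>2 + m) * recip (qfac Q m) ^ 2 * (recip (1 - z * Q ^ m) + recip (1 + z * Q ^ m))
      = 2 * (Q ^ (m\<^sup>2 + m) * recip (qfac Q m) ^ 2 * recip (1 - (z * Q ^ m)\<^sup>2))"
      by (simp only: mult.left_commute)
  qed simp
  finally show ?thesis unfolding sum_distrib_left[symmetric] by (simp only: mult.left_commute)
qed

text \<open>
  \<open>(q)\<^sub>\<infinity> \<Sum> ce(n) q\<^sup>n\<close> is the pentagonal false theta function. The factor
  \<open>2\<close> comes from averaging and is cancelled on coefficients.
\<close>
lemma ce_series_identity: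
  "cong_upto (Q ^ Suc N) (2 * (qfac Q N * (\<Sum>m\<le>N. gf (even_shape m) wt2)))
     (2 * (\<Sum>k\<le>N. Q ^ pent k - Q ^ (pent k + 2 * k + 1)))"
proof -
  have e: "(Q * Q ^ m)\<^sup>2 = Q ^ (2 * m + 2)" for m
    unfolding power_Suc[symmetric] power_even_eq[symmetric] by simp
  have "cong_upto (Q ^ Suc N) (appell_sum Q N Q + appell_sum Q N (- Q))
      (1 + (2 * (\<Sum>k\<le>N. Q ^ pent k - Q ^ (pent k + 2 * k + 1)) - 1))"
    by (intro cong_upto_add appell_sum_q[OF Q_nth_0] appell_sum_minus_q[OF Q_nth_0])
  then show ?thesis unfolding appell_sum_average[OF Q_nth_0] e gf_even_shape by simp
qed

lemma pent_double: "2 * pent k = k * (3 * k + 1)"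
  by (induction k) (simp_all add: pent_Suc algebra_simps)

lemma sum_pairs: "(\<Sum>k\<le>2 * N + 1. f k) = (\<Sum>j\<le>N. f (2 * j) + f (2 * j + 1))"
  for f :: "nat \<Rightarrow> 'a::comm_ring_1"
  by (induction N) (simp_all add: ac_simps)

lemma Q_square_X: "(fps_X * Q ^ m)\<^sup>2 = Q ^ (2 * m + 1)"
proof -
  have "(fps_X * Q ^ m)\<^sup>2 = fps_X ^ 2 * (Q ^ m) ^ 2" by (rule power_mult_distrib)
  then show ?thesis unfolding power_even_eq power_add power_one_right by (metis mult.commute)
qed

text \<open>
  \<open>(q)\<^sub>\<infinity> \<Sum> co1(n) q\<^sup>n\<close> is the same false theta function at
  \<open>q\<^sup>4\<close>: in the average over \<open>z = X\<close> and \<open>z = - X\<close>, of the two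
  monomials in the \<open>k\<close>-th term the first survives for even \<open>k\<close> and the second for odd
  \<open>k\<close>.
\<close>
lemma co1_series_identity:
  "cong_upto (Q ^ Suc (2 * N + 1))
     (2 * (qfac Q (2 * N + 1) * (\<Sum>m\<le>2 * N + 1. gf (odd1_shape m) wt2)))
     (2 * (\<Sum>k\<le>N. (Q\<^sup>2)\<^sup>2 ^ pent k - (Q\<^sup>2)\<^sup>2 ^ (pent k + 2 * k + 1)))"
proof -
  let ?t = "\<lambda>k. (- 1) ^ k * Q ^ pent k * fps_X ^ k * (1 + fps_X ^ (2 * k + 1))
      + (- 1) ^ k * Q ^ pent k * (- fps_X) ^ k * (1 + (- fps_X) ^ (2 * k + 1)) :: int fps"
  have z: "fps_nth (fps_X :: int fps) 0 = 0" "(- fps_X)\<^sup>2 = Q" "fps_nth (- fps_X :: int fps) 0 = 0"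
    by simp_all
  have "cong_upto (Q ^ Suc (2 * N + 1)) (appell_sum Q (2 * N + 1) fps_X + appell_sum Q (2 * N + 1) (- fps_X))
      (\<Sum>k\<le>2 * N + 1. ?t k)"
    unfolding sum.distrib
    by (intro cong_upto_add appell_sum_sqrt_q[OF Q_nth_0 refl z(1)] appell_sum_sqrt_q[OF Q_nth_0 z(2,3)])
  also have "(\<Sum>k\<le>2 * N + 1. ?t k)
      = (\<Sum>j\<le>N. 2 * ((Q\<^sup>2)\<^sup>2 ^ pent j - (Q\<^sup>2)\<^sup>2 ^ (pent j + 2 * j + 1)))"
    unfolding sum_pairs
  proof (rule sum.cong)
    fix j
    have Q4: "(Q\<^sup>2)\<^sup>2 ^ i = fps_X ^ (8 * i)" for i by (simp flip: power_mult)
    have p0: "2 * pent (2 * j) + 2 * j = 8 * pent j"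
      using pent_double[of j] pent_double[of "2 * j"] by (simp add: algebra_simps)
    have p1: "2 * pent (2 * j + 1) + (2 * j + 1 + (2 * (2 * j + 1) + 1)) = 8 * (pent j + 2 * j + 1)"
      using pent_double[of j] pent_double[of "2 * j + 1"] by (simp add: algebra_simps)
    have "?t (2 * j) = 2 * (Q ^ pent (2 * j) * fps_X ^ (2 * j))"
      by (simp add: algebra_simps)
    also have "\<dots> = 2 * (Q\<^sup>2)\<^sup>2 ^ pent j"
      unfolding Q4 p0[symmetric] power_add power_mult[of fps_X 2 "pent (2 * j)"] ..
    finally have 0: "?t (2 * j) = 2 * (Q\<^sup>2)\<^sup>2 ^ pent j" .
    have "?t (2 * j + 1) = - (2 * (Q ^ pent (2 * j + 1) * (fps_X ^ (2 * j + 1) * fps_X ^ (2 * (2 * j + 1) + 1))))"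
      by (simp add: algebra_simps)
    also have "\<dots> = - (2 * (Q\<^sup>2)\<^sup>2 ^ (pent j + 2 * j + 1))"
      unfolding Q4 p1[symmetric] power_mult[of fps_X 2 "pent (2 * j + 1)", symmetric]
        power_add[of fps_X "2 * pent (2 * j + 1)"] power_add[of fps_X "2 * j + 1"] ..
    finally have 1: "?t (2 * j + 1) = - (2 * (Q\<^sup>2)\<^sup>2 ^ (pent j + 2 * j + 1))" .
    show "?t (2 * j) + ?t (2 * j + 1) = 2 * ((Q\<^sup>2)\<^sup>2 ^ pent j - (Q\<^sup>2)\<^sup>2 ^ (pent j + 2 * j + 1))"
      unfolding 0 1 by (simp only: right_diff_distrib add_uminus_conv_diff)
  qed simp
  finally show ?thesis
    unfolding appell_sum_average[OF z(1)] Q_square_X gf_odd1_shape sum_distrib_left[symmetric] .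
qed

text \<open>
  Expanding \<open>1 / (1 - z q\<^sup>m) = 1 + z q\<^sup>m / (1 - z q\<^sup>m)\<close> reduces the exponent
  \<open>m\<^sup>2\<close> to Durfee's identity and to the exponent \<open>m\<^sup>2 + m\<close>.
\<close>
lemma co2_series_identity:
  "cong_upto (Q ^ Suc N) (2 * (qfac Q N * (\<Sum>m\<le>N. gf (odd2_shape m) wt2)))
     (2 + fps_X * (appell_sum Q N fps_X - appell_sum Q N (- fps_X)))"
proof -
  have r: "2 * recip (1 - Q ^ (2 * m + 1)) =
      2 + fps_X * (Q ^ m * recip (1 - fps_X * Q ^ m)) - fps_X * (Q ^ m * recip (1 - (- fps_X) * Q ^ m))" for m
  proof -
    have z: "fps_nth (fps_X * Q ^ m) 0 = 0" by simp
    have z': "fps_nth (- fps_X * Q ^ m) 0 = 0" by simp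
    have "2 * recip (1 - Q ^ (2 * m + 1)) = recip (1 - fps_X * Q ^ m) + recip (1 - (- fps_X) * Q ^ m)"
      using recip_average[OF z] unfolding Q_square_X mult_minus_left diff_minus_eq_add ..
    also have "\<dots> = (1 + fps_X * Q ^ m * recip (1 - fps_X * Q ^ m))
        + (1 + (- fps_X) * Q ^ m * recip (1 - (- fps_X) * Q ^ m))"
      by (rule arg_cong2[of _ _ _ _ "(+)", OF recip_fixpoint[OF z] recip_fixpoint[OF z']])
    finally show ?thesis by (simp add: mult.assoc)
  qed
  have "2 * (qfac Q N * (\<Sum>m\<le>N. gf (odd2_shape m) wt2))
      = qfac Q N * (\<Sum>m\<le>N. Q ^ m\<^sup>2 * recip (qfac Q m) ^ 2 * (2 * recip (1 - Q ^ (2 * m + 1))))"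
    unfolding gf_odd2_shape sum_distrib_left by (rule sum.cong) (simp_all only: ac_simps)
  also have "\<dots> = 2 * (qfac Q N * (\<Sum>m\<le>N. Q ^ m\<^sup>2 * recip (qfac Q m) ^ 2))
      + fps_X * (appell_sum Q N fps_X - appell_sum Q N (- fps_X))"
    unfolding r appell_sum_def[OF Q_nth_0] sum_distrib_left
      right_diff_distrib distrib_left sum.distrib sum_subtractf
    by (simp only: ac_simps add_diff_eq)
  also have "cong_upto (Q ^ Suc N) \<dots> (2 * 1 + fps_X * (appell_sum Q N fps_X - appell_sum Q N (- fps_X)))"
    by (intro cong_upto_add cong_upto_mult cong_upto_refl durfee_upto[OF Q_nth_0])
  finally show ?thesis by simp
qed

text \<open>
  Every monomial has an odd exponent of \<open>q\<close>, that is, an exponent of \<open>X\<close> that is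
  \<open>2\<close> modulo \<open>4\<close>.
\<close>
lemma co2_series_support:
  assumes "i > 0" "4 * i < 2 * Suc N"
  shows "fps_nth (fps_X * (appell_sum Q N fps_X - appell_sum Q N (- fps_X))) (4 * i) = 0"
proof -
  let ?t = "\<lambda>k. (- 1) ^ k * Q ^ pent k * fps_X ^ k * (1 + fps_X ^ (2 * k + 1))
      - (- 1) ^ k * Q ^ pent k * (- fps_X) ^ k * (1 + (- fps_X) ^ (2 * k + 1)) :: int fps"
  have z: "fps_nth (fps_X :: int fps) 0 = 0" "(- fps_X)\<^sup>2 = Q" "fps_nth (- fps_X :: int fps) 0 = 0"
    by simp_all
  have "cong_upto (Q ^ Suc N) (fps_X * (appell_sum Q N fps_X - appell_sum Q N (- fps_X)))
      (fps_X * (\<Sum>k\<le>N. ?t k))"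
    unfolding sum_subtractf
    by (intro cong_upto_mult cong_upto_refl cong_upto_diff
        appell_sum_sqrt_q[OF Q_nth_0 refl z(1)] appell_sum_sqrt_q[OF Q_nth_0 z(2,3)])
  from cong_upto_nth[OF this assms(2)]
  have "fps_nth (fps_X * (appell_sum Q N fps_X - appell_sum Q N (- fps_X))) (4 * i)
      = (\<Sum>k\<le>N. fps_nth (fps_X * ?t k) (4 * i))"
    by (simp only: sum_distrib_left fps_sum_nth)
  also have "\<dots> = 0"
  proof (rule sum.neutral, rule ballI)
    fix k :: nat
    have coeff: "fps_nth (2 * fps_X ^ e :: int fps) (4 * i) = 0" if "e = 4 * x + 2" for e x
    proof -
      have "4 * i \<noteq> e" using that by presburger
      then show ?thesis unfolding numeral_fps_const fps_mult_left_const_nth fps_X_power_nth by simp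
    qed
    have Qpow: "fps_X * (Q ^ a * fps_X ^ b) = fps_X ^ (2 * a + b + 1)" for a b
      unfolding power_mult[symmetric] by (simp add: power_add)
    obtain j where "k = 2 * j \<or> k = 2 * j + 1" by (metis oddE evenE)
    then show "fps_nth (fps_X * ?t k) (4 * i) = 0"
    proof
      assume k: "k = 2 * j"
      have "?t k = 2 * (Q ^ pent k * (fps_X ^ k * fps_X ^ (2 * k + 1)))"
        unfolding k by (simp add: algebra_simps)
      then have "?t k = 2 * (Q ^ pent k * fps_X ^ (k + (2 * k + 1)))"
        unfolding power_add[of fps_X k] .
      then have "fps_X * ?t k = 2 * fps_X ^ (2 * pent k + (k + (2 * k + 1)) + 1)"
        by (simp only: mult.left_commute[of fps_X 2] Qpow)
      moreover have "2 * pent k + (k + (2 * k + 1)) + 1 = 4 * (3 * j * j + 2 * j) + 2"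
        using pent_double[of k] by (simp add: k algebra_simps)
      ultimately show ?thesis using coeff by presburger
    next
      assume k: "k = 2 * j + 1"
      have "?t k = - (2 * (Q ^ pent k * fps_X ^ k))"
        unfolding k by (simp add: algebra_simps)
      then have "fps_X * ?t k = - (2 * fps_X ^ (2 * pent k + k + 1))"
        by (simp only: mult_minus_right mult.left_commute[of fps_X 2] Qpow)
      moreover have "2 * pent k + k + 1 = 4 * (3 * j * j + 4 * j + 1) + 2"
        using pent_double[of k] by (simp add: k algebra_simps)
      ultimately show ?thesis using coeff by (metis fps_neg_nth neg_0_equal_iff_equal)
    qed
  qed
  finally show ?thesis .
qed

section \<open>The pentagonal recurrence modulo 2\<close>

definition shifted :: "(nat \<Rightarrow> int) \<Rightarrow> nat \<Rightarrow> nat \<Rightarrow> int" where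
  "shifted u n e = (if e \<le> n then u (n - e) else 0)"

text \<open>
  The coefficient of \<open>q\<^sup>n\<close> in \<open>(q)\<^sub>\<infinity> \<Sum> u(j) q\<^sup>j\<close>, by
  the pentagonal number theorem.
\<close>
definition pent_rec :: "(nat \<Rightarrow> int) \<Rightarrow> nat \<Rightarrow> int" where
  "pent_rec u n = (\<Sum>k\<le>n. (- 1) ^ k * (shifted u n (pent k) - shifted u n (pent k + 2 * k + 1)))"

lemma le_pent: "k \<le> pent k"
  by (induction k) (simp_all add: pent_Suc)

lemma pent_mono: "j \<le> k \<Longrightarrow> pent j \<le> pent k"
  by (induction k rule: dec_induct) (simp_all add: pent_Suc)

lemma pent_less: "j < k \<Longrightarrow> pent j + 2 * j + 1 < pent k"
  using pent_mono[of "Suc j" k] by (simp add: pent_Suc)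

lemma nth_Q_power_mult: "fps_nth (Q ^ e * G) (2 * n) = (if e \<le> n then fps_nth G (2 * (n - e)) else 0)"
  unfolding power_mult[symmetric] fps_X_power_mult_nth by (auto simp: diff_mult_distrib2)

lemma nth_minus_one_power_mult: "fps_nth ((- 1) ^ k * f) n = (- 1) ^ k * fps_nth (f :: int fps) n"
  by (cases "even k") simp_all

lemma nth_pentagonal_mult:
  assumes "\<And>j. j \<le> n \<Longrightarrow> fps_nth G (2 * j) = u j" "n \<le> N"
  shows "fps_nth ((\<Sum>k\<le>N. (- 1) ^ k * (Q ^ pent k - Q ^ (pent k + 2 * k + 1))) * G) (2 * n)
      = pent_rec u n"
proof -
  have s: "(if e \<le> n then fps_nth G (2 * (n - e)) else 0) = shifted u n e" for e
    using assms(1)[of "n - e"] by (simp add: shifted_def)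
  have "fps_nth ((\<Sum>k\<le>N. (- 1) ^ k * (Q ^ pent k - Q ^ (pent k + 2 * k + 1))) * G) (2 * n)
      = (\<Sum>k\<le>N. (- 1) ^ k * (shifted u n (pent k) - shifted u n (pent k + 2 * k + 1)))"
    unfolding sum_distrib_right fps_sum_nth mult.assoc nth_minus_one_power_mult
      left_diff_distrib fps_sub_nth nth_Q_power_mult s ..
  also have "\<dots> = pent_rec u n"
    unfolding pent_rec_def
  proof (rule sum.mono_neutral_right)
    show "\<forall>k\<in>{..N} - {..n}. (- 1) ^ k * (shifted u n (pent k) - shifted u n (pent k + 2 * k + 1)) = 0"
    proof
      fix k assume "k \<in> {..N} - {..n}"
      then have "n < pent k" using le_pent[of k] by auto
      then show "(- 1) ^ k * (shifted u n (pent k) - shifted u n (pent k + 2 * k + 1)) = 0"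
        by (simp add: shifted_def)
    qed
  qed (use assms in auto)
  finally show ?thesis .
qed

lemma pent_rec_eqI:
  assumes "cong_upto (Q ^ Suc N) (2 * (qfac Q N * G)) H"
    and "\<And>j. j \<le> n \<Longrightarrow> fps_nth G (2 * j) = u j" "n \<le> N"
  shows "2 * pent_rec u n = fps_nth H (2 * n)"
proof -
  let ?p = "\<Sum>k\<le>N. (- 1) ^ k * (Q ^ pent k - Q ^ (pent k + 2 * k + 1))"
  have "cong_upto (Q ^ Suc N) (2 * (?p * G)) (2 * (qfac Q N * G))"
    by (intro cong_upto_mult cong_upto_refl cong_upto_sym[OF pentagonal_upto[OF Q_nth_0]])
  from cong_upto_trans[OF this assms(1)] have "fps_nth (2 * (?p * G)) (2 * n) = fps_nth H (2 * n)"
    by (rule cong_upto_nth) (use assms(3) in simp)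
  moreover have "fps_nth (?p * G) (2 * n) = pent_rec u n"
    by (rule nth_pentagonal_mult) (use assms(2,3) in auto)
  ultimately show ?thesis
    unfolding numeral_fps_const fps_mult_left_const_nth by simp
qed

lemma pent_rec_diff: "pent_rec (\<lambda>n. u n - v n) n = pent_rec u n - pent_rec v n"
  unfolding pent_rec_def sum_subtractf[symmetric]
  by (rule sum.cong) (auto simp: shifted_def algebra_simps)

lemma pent_rec_double: "pent_rec (\<lambda>n. 2 * v n) n = 2 * pent_rec v n"
  unfolding pent_rec_def sum_distrib_left
  by (rule sum.cong) (auto simp: shifted_def algebra_simps)

text \<open>
  The recurrence expresses \<open>u n\<close> by its value at \<open>n\<close> and by earlier values of
  \<open>u\<close>, with integer coefficients.
\<close>
lemma even_if_pent_rec_even: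
  assumes "\<And>n. even (pent_rec u n)"
  shows "even (u n)"
proof (induction n rule: less_induct)
  case (less n)
  have sh: "even (shifted u n e)" if "e > 0" for e
    using less[of "n - e"] that by (auto simp: shifted_def)
  have "u n = (\<Sum>k\<le>n. if k = 0 then u n else 0)" by simp
  then have "pent_rec u n - u n = (\<Sum>k\<le>n. (- 1) ^ k * (shifted u n (pent k) - shifted u n (pent k + 2 * k + 1))
      - (if k = 0 then u n else 0))"
    unfolding pent_rec_def sum_subtractf by simp
  moreover have "even \<dots>"
  proof (rule dvd_sum)
    fix k assume "k \<in> {..n}"
    show "even ((- 1) ^ k * (shifted u n (pent k) - shifted u n (pent k + 2 * k + 1))
      - (if k = 0 then u n else 0))"
    proof (cases "k = 0")
      case True
      then show ?thesis using sh[of 1] by (simp add: shifted_def)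
    next
      case False
      then have "0 < pent k" using le_pent[of k] by linarith
      then show ?thesis using False sh[of "pent k"] sh[of "pent k + 2 * k + 1"] by simp
    qed
  qed
  ultimately show ?case using assms[of n] by (metis dvd_diff_right_iff)
qed

definition pents :: "nat set" where
  "pents = range pent \<union> range (\<lambda>k. pent k + 2 * k + 1)"

text \<open>
  Exactly \<open>2 * k + 1\<close> pentagonal numbers are at most \<open>n\<close>. If all values \<open>u (n -
  e)\<close> were odd, the recurrence would be a sum of an odd number of odd terms.
\<close>
lemma even_witness:
  assumes n: "pent k \<le> n" "n < pent k + 2 * k + 1" and "even (pent_rec u n)"
  shows "\<exists>e\<in>pents. e \<le> n \<and> even (u (n - e))"
proof (rule ccontr)
  assume *: "\<not> ?thesis"
  have odd: "odd (u (n - pent j))" if "pent j \<le> n" for j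
    using * that by (auto simp: pents_def)
  have odd': "odd (u (n - (pent j + 2 * j + 1)))" if "pent j + 2 * j + 1 \<le> n" for j
    using * that by (auto simp: pents_def)
  have "k \<le> n" using le_pent[of k] n by linarith
  then have "1 = (\<Sum>j\<le>n. if j = k then 1 else 0 :: int)" by simp
  then have "pent_rec u n - 1 = (\<Sum>j\<le>n. (- 1) ^ j * (shifted u n (pent j) - shifted u n (pent j + 2 * j + 1))
      - (if j = k then 1 else 0))"
    unfolding pent_rec_def sum_subtractf by simp
  moreover have "even \<dots>"
  proof (rule dvd_sum)
    fix j assume "j \<in> {..n}"
    consider "j < k" | "j = k" | "j > k" by linarith
    then show "even ((- 1) ^ j * (shifted u n (pent j) - shifted u n (pent j + 2 * j + 1))
      - (if j = k then 1 else 0))"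
    proof cases
      case 1
      then have "pent j + 2 * j + 1 \<le> n" "pent j \<le> n" using pent_less[OF 1] n by linarith+
      then show ?thesis using 1 odd[of j] odd'[of j] by (simp add: shifted_def)
    next
      case 2
      then show ?thesis using odd[of k] n by (simp add: shifted_def)
    next
      case 3
      then have "n < pent j" using pent_less[OF 3] n by linarith
      then show ?thesis using 3 by (simp add: shifted_def)
    qed
  qed
  ultimately show False using assms(3) by (metis dvd_diff_right_iff odd_one)
qed

section \<open>The recurrences of the three counting functions\<close>

lemma nth_Q_power: "fps_nth (Q ^ e) (2 * n) = (if n = e then 1 else 0)"
  unfolding power_mult[symmetric] fps_X_power_nth by simp

lemma nth_double: "fps_nth (2 * f :: int fps) n = 2 * fps_nth f n"
  unfolding numeral_fps_const fps_mult_left_const_nth ..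

text \<open>
  Removing the constant term of the generating function subtracts \<open>(q)\<^sub>\<infinity>\<close> from the
  false theta function. Both have coefficients \<open>1\<close> and \<open>- 1\<close> at the pentagonal numbers,
  so all coefficients of the difference are even.
\<close>
lemma ce_pent_rec:
  "pent_rec (\<lambda>n. int (ce n) - (if n = 0 then 1 else 0)) n
   = (\<Sum>k\<le>n. (1 - (- 1) ^ k) * ((if n = pent k then 1 else 0) - (if n = pent k + 2 * k + 1 then 1 else 0)))"
proof -
  have "2 * pent_rec (\<lambda>n. int (ce n)) n
      = fps_nth (2 * (\<Sum>k\<le>n. Q ^ pent k - Q ^ (pent k + 2 * k + 1))) (2 * n)"
    by (rule pent_rec_eqI[OF ce_series_identity]) (simp_all add: ce_eq)
  then have "pent_rec (\<lambda>n. int (ce n)) n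
      = (\<Sum>k\<le>n. (if n = pent k then 1 else 0) - (if n = pent k + 2 * k + 1 then 1 else 0))"
    by (simp only: nth_double fps_sum_nth fps_sub_nth nth_Q_power)
  moreover have "pent_rec (\<lambda>n. if n = 0 then 1 else 0) n
      = fps_nth ((\<Sum>k\<le>n. (- 1) ^ k * (Q ^ pent k - Q ^ (pent k + 2 * k + 1))) * 1) (2 * n)"
    by (rule nth_pentagonal_mult[symmetric]) auto
  then have "pent_rec (\<lambda>n. if n = 0 then 1 else 0) n
      = (\<Sum>k\<le>n. (- 1) ^ k * ((if n = pent k then 1 else 0) - (if n = pent k + 2 * k + 1 then 1 else 0)))"
    by (simp only: mult_1_right fps_sum_nth fps_sub_nth nth_minus_one_power_mult nth_Q_power)
  ultimately show ?thesis
    unfolding pent_rec_diff by (simp only: left_diff_distrib mult_1_left sum_subtractf)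
qed

lemma ce_even: "even (int (ce n) - (if n = 0 then 1 else 0))"
proof (rule even_if_pent_rec_even[where u = "\<lambda>n. int (ce n) - (if n = 0 then 1 else 0)"])
  fix n
  show "even (pent_rec (\<lambda>n. int (ce n) - (if n = 0 then 1 else 0)) n)"
    unfolding ce_pent_rec by (intro dvd_sum dvd_mult2) simp
qed

lemma ce_vanishing:
  assumes "n \<notin> pents"
  shows "pent_rec (\<lambda>n. int (ce n) - (if n = 0 then 1 else 0)) n = 0"
  unfolding ce_pent_rec using assms by (auto simp: pents_def intro!: sum.neutral)

lemma co2_vanishing:
  assumes "even n" "n > 0"
  shows "pent_rec (\<lambda>n. int (co2 n)) n = 0"
proof -
  obtain i where i: "n = 2 * i" using \<open>even n\<close> by (rule evenE)
  have "2 * pent_rec (\<lambda>n. int (co2 n)) n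
      = fps_nth (2 + fps_X * (appell_sum Q n fps_X - appell_sum Q n (- fps_X))) (2 * n)"
    by (rule pent_rec_eqI[OF co2_series_identity]) (simp_all add: co2_eq)
  also have "\<dots> = fps_nth (2 :: int fps) (4 * i) + fps_nth (fps_X * (appell_sum Q n fps_X - appell_sum Q n (- fps_X))) (4 * i)"
    by (simp add: i)
  also have "fps_nth (fps_X * (appell_sum Q n fps_X - appell_sum Q n (- fps_X))) (4 * i) = 0"
    by (rule co2_series_support) (use i assms in auto)
  also have "fps_nth (2 :: int fps) (4 * i) = 0"
    using i assms by (simp add: numeral_fps_const)
  finally show ?thesis by simp
qed

lemma tri_eq: "Suc i choose 2 = i * (i + 1) div 2"
proof -
  have "(Suc i choose 2) * 2 = i * (i + 1)" by (induction i) (simp_all add: choose_two_Suc)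
  then show ?thesis by (metis nonzero_mult_div_cancel_right zero_neq_numeral)
qed

lemma tri_inj: "Suc i choose 2 = Suc j choose 2 \<Longrightarrow> i = j"
proof -
  have "strict_mono (\<lambda>i. Suc i choose 2)"
    unfolding strict_mono_Suc_iff by (simp add: choose_two_Suc[of "Suc _"])
  then show "Suc i choose 2 = Suc j choose 2 \<Longrightarrow> i = j" using strict_mono_eq by blast
qed

lemma nth_theta:
  assumes "j \<le> N"
  shows "fps_nth (\<Sum>i\<le>N. Q ^ (Suc i choose 2)) (2 * j) = (if triangular j then 1 else 0)"
proof (cases "triangular j")
  case True
  then obtain i where i: "j = Suc i choose 2" unfolding triangular_def tri_eq by blast
  have "i \<le> N" using le_choose_two_Suc[of i] i assms by linarith
  have "fps_nth (\<Sum>i\<le>N. Q ^ (Suc i choose 2)) (2 * j) = (\<Sum>l\<le>N. if l = i then 1 else 0)"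
    unfolding fps_sum_nth nth_Q_power by (rule sum.cong) (use tri_inj i in auto)
  then show ?thesis using True \<open>i \<le> N\<close> by simp
next
  case False
  then have "j \<noteq> Suc i choose 2" for i unfolding triangular_def tri_eq by blast
  then show ?thesis using False unfolding fps_sum_nth nth_Q_power by simp
qed

text \<open>
  Exponents of \<open>X\<close> divisible by \<open>4\<close> are even exponents of \<open>q\<close>.
\<close>
definition supp4 :: "int fps \<Rightarrow> bool" where
  "supp4 f \<longleftrightarrow> (\<forall>k. \<not> 4 dvd k \<longrightarrow> fps_nth f k = 0)"

lemma supp4_mult:
  assumes "supp4 f" "supp4 g"
  shows "supp4 (f * g)"
  unfolding supp4_def
proof (intro allI impI)
  fix k :: nat assume k: "\<not> 4 dvd k"
  have "fps_nth f i * fps_nth g (k - i) = 0" if "i \<in> {0..k}" for i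
  proof (cases "4 dvd i")
    case True
    then have "\<not> 4 dvd k - i" using k that by (metis atLeastAtMost_iff dvd_diffD)
    then show ?thesis using assms by (simp add: supp4_def)
  next
    case False
    then show ?thesis using assms by (simp add: supp4_def)
  qed
  then show "fps_nth (f * g) k = 0" unfolding fps_mult_nth by (rule sum.neutral[OF ballI])
qed

lemma supp4_qfac: "supp4 (qfac (Q\<^sup>2) n)"
proof (induction n)
  case (Suc n)
  have "supp4 (1 - (Q\<^sup>2) ^ Suc n)"
    unfolding power_mult[symmetric] supp4_def by auto
  then show ?case
    using Suc supp4_mult by (simp add: qfac_Suc del: power_Suc)
qed (simp add: qfac_0 supp4_def)

text \<open>
  Modulo \<open>2\<close>, squaring is additive.
\<close>
lemma qfac_square_mod_2:
  assumes "fps_nth q 0 = 0"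
  shows "2 dvd qfac (q\<^sup>2) n - qfac q n ^ 2"
proof (induction n)
  case (Suc n)
  have sq: "fps_nth (q\<^sup>2) 0 = 0" using assms by (simp add: power2_eq_square)
  define y where "y = q ^ Suc n"
  have "qfac (q\<^sup>2) (Suc n) - qfac q (Suc n) ^ 2
      = (qfac (q\<^sup>2) n - qfac q n ^ 2) * (1 - y\<^sup>2) + 2 * (qfac q n ^ 2 * (y - y\<^sup>2))"
  proof -
    have "(q\<^sup>2) ^ Suc n = y\<^sup>2" unfolding y_def by (metis power_mult mult.commute)
    then show ?thesis
      unfolding qfac_Suc[OF assms] qfac_Suc[OF sq] y_def[symmetric]
      by (simp add: power_mult_distrib power2_eq_square algebra_simps)
  qed
  then show ?case using Suc by (metis dvd_add dvd_mult2 dvd_triv_left)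
qed (simp add: qfac_0[OF assms] qfac_0[of "q\<^sup>2"] assms power2_eq_square)

lemma qfac_upto:
  assumes "fps_nth q 0 = 0" "N \<le> M"
  shows "cong_upto (q ^ Suc N) (qfac q M) (qfac q N)"
proof -
  have "cong_upto (q ^ Suc N) (qfac q N * (qfac q M * recip (qfac q N))) (qfac q N * 1)"
    by (intro cong_upto_mult cong_upto_refl cong_upto_qfac_ratio assms)
  moreover have "qfac q N * (qfac q M * recip (qfac q N)) = qfac q M"
    using qfac_recip[OF assms(1), of N] by (simp add: mult.left_commute)
  ultimately show ?thesis by simp
qed

abbreviation Q4 :: "int fps" where "Q4 \<equiv> (Q\<^sup>2)\<^sup>2"

lemma Q4_nth_0: "fps_nth Q4 0 = 0"
  by (simp add: power2_eq_square)

text \<open>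
  The correction in \<open>co1'\<close> subtracts the series over triangular exponents, which Gauss's identity
  evaluates.
\<close>
lemma co1_pent_rec:
  "pent_rec co1' n = fps_nth ((\<Sum>k\<le>n. Q4 ^ pent k - Q4 ^ (pent k + 2 * k + 1))
     - qfac (Q\<^sup>2) (2 * n + 1) ^ 2) (2 * n)" (is "_ = fps_nth (?F - ?q) _")
proof -
  let ?M = "2 * n + 1"
  let ?O = "\<Sum>m\<le>?M. gf (odd1_shape m) wt2" and ?T = "\<Sum>i\<le>?M. Q ^ (Suc i choose 2)"
  have "cong_upto (Q ^ Suc ?M) (2 * (qfac Q ?M * ?O) - 2 * (qfac Q ?M * ?T)) (2 * ?F - 2 * ?q)"
    by (intro cong_upto_diff co1_series_identity cong_upto_mult[OF cong_upto_refl] gauss_upto Q_nth_0) simp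
  then have "cong_upto (Q ^ Suc ?M) (2 * (qfac Q ?M * (?O - ?T))) (2 * (?F - ?q))"
    by (simp only: right_diff_distrib)
  then have "2 * pent_rec co1' n = fps_nth (2 * (?F - ?q)) (2 * n)"
  proof (rule pent_rec_eqI)
    fix j assume "j \<le> n"
    then have "j \<le> ?M" by simp
    then show "fps_nth (?O - ?T) (2 * j) = co1' j"
      unfolding fps_sub_nth nth_theta[OF \<open>j \<le> ?M\<close>] co1_eq[OF \<open>j \<le> ?M\<close>, symmetric] co1'_def by simp
  qed simp
  then show ?thesis unfolding nth_double by simp
qed

text \<open>
  Both the false theta function at \<open>q\<^sup>4\<close> and \<open>(q\<^sup>2;
  q\<^sup>2)\<^sub>\<infinity>\<^sup>2\<close> are even functions of \<open>q\<close>.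
\<close>
lemma co1_vanishing:
  assumes "odd n"
  shows "pent_rec co1' n = 0"
proof -
  have n: "\<not> 4 dvd 2 * n" using assms by presburger
  have p: "fps_nth (Q4 ^ e) (2 * n) = 0" for e
  proof -
    have "2 * n \<noteq> 2 * 2 * 2 * e" using n by presburger
    then show ?thesis unfolding power_mult[symmetric] fps_X_power_nth by simp
  qed
  have "supp4 (qfac (Q\<^sup>2) (2 * n + 1) ^ 2)"
    unfolding power2_eq_square[of "qfac _ _"] by (intro supp4_mult supp4_qfac)
  then show ?thesis
    unfolding co1_pent_rec fps_sub_nth fps_sum_nth p supp4_def using n by simp
qed

text \<open>
  Modulo \<open>2\<close>, the false theta function at \<open>q\<^sup>4\<close> agrees with the pentagonal series
  \<open>(q\<^sup>4; q\<^sup>4)\<^sub>\<infinity>\<close>, and so does \<open>(q\<^sup>2;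
  q\<^sup>2)\<^sub>\<infinity>\<^sup>2\<close>.
\<close>
lemma co1_even: "even (co1' n)"
proof (rule even_if_pent_rec_even[where u = co1'])
  fix n
  let ?M = "2 * n + 1" and ?q = "qfac (Q\<^sup>2) (2 * n + 1) ^ 2"
  let ?F = "\<Sum>k\<le>n. Q4 ^ pent k - Q4 ^ (pent k + 2 * k + 1)"
  let ?P = "\<Sum>k\<le>n. (- 1) ^ k * (Q4 ^ pent k - Q4 ^ (pent k + 2 * k + 1))"
  have "2 dvd ?F - ?P"
    unfolding sum_subtractf[symmetric]
  proof (rule dvd_sum)
    fix k
    have "2 dvd d - (- 1) ^ k * d" for d :: "int fps"
    proof (cases "even k")
      case False
      then have "d - (- 1) ^ k * d = 2 * d" by simp
      then show ?thesis by (simp only: dvd_triv_left)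
    qed simp
    then show "2 dvd Q4 ^ pent k - Q4 ^ (pent k + 2 * k + 1)
        - (- 1) ^ k * (Q4 ^ pent k - Q4 ^ (pent k + 2 * k + 1))" .
  qed
  moreover have "2 dvd qfac Q4 ?M - ?q"
    by (rule qfac_square_mod_2) (simp only: power2_eq_square[of Q] fps_mult_nth_0 Q_nth_0 mult_zero_left)
  moreover have "fps_nth (?P - qfac Q4 ?M) (2 * n) = 0"
  proof -
    have "cong_upto (Q4 ^ Suc n) (qfac Q4 ?M) ?P"
      by (rule cong_upto_trans[OF qfac_upto[OF Q4_nth_0] pentagonal_upto[OF Q4_nth_0]]) simp
    moreover have "Q dvd Q4"
      by (rule dvdI[of _ _ "fps_X ^ 6"]) (simp flip: power_mult power_add)
    ultimately have "cong_upto (Q ^ Suc n) (qfac Q4 ?M) ?P"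
      by (rule cong_upto_dvd[OF _ dvd_power_same])
    from cong_upto_nth[OF this, of "2 * n"] show ?thesis by simp
  qed
  ultimately have "even (fps_nth (?F - ?P) (2 * n) + fps_nth (qfac Q4 ?M - ?q) (2 * n)
      + fps_nth (?P - qfac Q4 ?M) (2 * n))"
    using even_coefficient[of "?F - ?P"] even_coefficient[of "qfac Q4 ?M - ?q"] by (simp only: dvd_add add_0_right)
  also have "fps_nth (?F - ?P) (2 * n) + fps_nth (qfac Q4 ?M - ?q) (2 * n)
      + fps_nth (?P - qfac Q4 ?M) (2 * n) = fps_nth (?F - ?q) (2 * n)"
    unfolding fps_sub_nth by linarith
  finally show "even (pent_rec co1' n)" unfolding co1_pent_rec .
qed

section \<open>Counting the values divisible by 4 or 2\<close>

lemma parity_class_card: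
  assumes "r < 2"
  shows "k \<le> card {n. n mod 2 = r \<and> a \<le> n \<and> n < a + 2 * k + (1 :: nat)}"
proof -
  let ?A = "{n. n mod 2 = r \<and> a \<le> n \<and> n < a + 2 * k + 1}"
  define b where "b = (a + r) mod 2"
  \<comment> \<open>\<open>a + b\<close> is the first integer from \<open>a\<close> on with residue \<open>r\<close>\<close>
  have b: "(a + b) mod 2 = r" "b \<le> 1"
    unfolding b_def mod_add_right_eq using assms by presburger+
  have "(\<lambda>i. a + b + 2 * i) ` {..<k} \<subseteq> ?A"
  proof (rule image_subsetI)
    fix i assume "i \<in> {..<k}"
    then have "a + b + 2 * i < a + 2 * k + 1" using b(2) by simp
    moreover have "(a + b + 2 * i) mod 2 = r" using b(1) by (simp only: mod_mult_self2)
    ultimately show "a + b + 2 * i \<in> ?A" by simp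
  qed
  moreover have "finite ?A"
    by (rule finite_subset[of _ "{..<a + 2 * k + 1}"]) auto
  ultimately have "card ((\<lambda>i. a + b + 2 * i) ` {..<k}) \<le> card ?A" by (intro card_mono)
  moreover have "card ((\<lambda>i. a + b + 2 * i) ` {..<k}) = k"
    by (subst card_image) (simp_all add: inj_on_def)
  ultimately show ?thesis by simp
qed

text \<open>
  Let \<open>K\<close> be the number of complete blocks \<open>[pent k, pent k + 2 k + 1)\<close> below
  \<open>X\<close>. They contain at least \<open>0 + 1 + \<dots> + (K - 1) = K (K - 1) / 2\<close> elements of
  \<open>B\<close>, each of which is the sum of a pentagonal number and a solution of \<open>R\<close> below
  \<open>X\<close>. There are at most \<open>2 K + 1\<close> pentagonal numbers below \<open>X\<close>, so there
  are at least \<open>K (K - 1) / (4 K + 2) \<ge> K / 4 - 3 / 8\<close> solutions, and \<open>\<surd>(24 X + 1)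
  \<le> 6 K + 5\<close> gives the stated bound.
\<close>
lemma count_bound:
  fixes X :: real
  assumes many: "\<And>k. k \<le> card {n \<in> B. pent k \<le> n \<and> n < pent k + 2 * k + 1}"
    and witness: "\<And>n k. n \<in> B \<Longrightarrow> pent k \<le> n \<Longrightarrow> n < pent k + 2 * k + 1
      \<Longrightarrow> \<exists>e\<in>pents. e \<le> n \<and> R (n - e)"
    and "X \<ge> 0"
  shows "(sqrt (24 * X + 1) - 14) / 24 \<le> real (card {m. real m < X \<and> R m})"
proof -
  let ?b = "\<lambda>k. pent k + 2 * k + 1"
  let ?I = "\<lambda>k. {n \<in> B. pent k \<le> n \<and> n < ?b k}"
  let ?M = "{m. real m < X \<and> R m}"
  have "\<exists>k. X < real (?b k)"
  proof
    show "X < real (?b (nat \<lceil>X\<rceil>))" using le_pent[of "nat \<lceil>X\<rceil>"] by linarith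
  qed
  define K where "K = (LEAST k. X < real (?b k))"
  have K: "X < real (?b K)" unfolding K_def by (rule LeastI_ex) fact
  have below: "real (?b k) \<le> X" if "k < K" for k
    using not_less_Least[of k "\<lambda>k. X < real (?b k)"] that unfolding K_def by linarith
  define W where "W = pent ` {..K} \<union> ?b ` {..<K}"
  have card_W: "card W \<le> 2 * K + 1"
  proof -
    have "card W \<le> card (pent ` {..K}) + card (?b ` {..<K})"
      unfolding W_def by (rule card_Un_le)
    also have "\<dots> \<le> card {..K} + card {..<K}"
      by (intro add_mono card_image_le) auto
    finally show ?thesis by simp
  qed
  have finite_M: "finite ?M"
    by (rule finite_subset[of _ "{..nat \<lceil>X\<rceil>}"]) (auto, linarith)
  have "(\<Sum>k<K. k) \<le> (\<Sum>k<K. card (?I k))"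
    by (rule sum_mono) (rule many)
  also have "\<dots> = card (\<Union>k<K. ?I k)"
  proof (rule card_UN_disjoint[symmetric])
    show "\<forall>i\<in>{..<K}. \<forall>j\<in>{..<K}. i \<noteq> j \<longrightarrow> ?I i \<inter> ?I j = {}"
    proof (intro ballI impI)
      fix i j :: nat assume "i \<noteq> j"
      then consider "i < j" | "j < i" by linarith
      then show "?I i \<inter> ?I j = {}"
        using pent_less[of i j] pent_less[of j i] by cases auto
    qed
  qed auto
  also have "\<dots> \<le> card ((\<lambda>(e, m). e + m) ` (W \<times> ?M))"
  proof (rule card_mono)
    show "finite ((\<lambda>(e, m). e + m) ` (W \<times> ?M))"
      using finite_M by (intro finite_imageI finite_cartesian_product) (simp_all add: W_def)
    show "(\<Union>k<K. ?I k) \<subseteq> (\<lambda>(e, m). e + m) ` (W \<times> ?M)"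
    proof
      fix n assume "n \<in> (\<Union>k<K. ?I k)"
      then obtain k where k: "k < K" "n \<in> B" "pent k \<le> n" "n < ?b k" by auto
      then obtain e where e: "e \<in> pents" "e \<le> n" "R (n - e)" using witness by blast
      have nX: "real n < X" using below[OF k(1)] k(4) by linarith
      have "e \<in> W"
      proof -
        have eX: "real e < X" using nX e(2) by linarith
        from e(1) consider j where "e = pent j" | j where "e = ?b j" unfolding pents_def by blast
        then show ?thesis
        proof cases
          case 1
          have "j \<le> K"
          proof (rule ccontr)
            assume "\<not> j \<le> K"
            then have "?b K < e" using pent_less[of K j] 1 by simp
            then show False using eX K by linarith
          qed
          then show ?thesis using 1 by (simp add: W_def)
        next
          case 2
          have "j < K"
          proof (rule ccontr)
            assume "\<not> j < K"
            then have "?b K \<le> e" using pent_mono[of K j] 2 by simp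
            then show False using eX K by linarith
          qed
          then show ?thesis using 2 by (simp add: W_def)
        qed
      qed
      moreover have "n - e \<in> ?M" using e(3) nX by simp
      ultimately show "n \<in> (\<lambda>(e, m). e + m) ` (W \<times> ?M)"
        using e(2) by (intro image_eqI[of _ _ "(e, n - e)"]) auto
    qed
  qed
  also have "\<dots> \<le> card (W \<times> ?M)"
    using finite_M by (intro card_image_le finite_cartesian_product) (simp_all add: W_def)
  also have "\<dots> \<le> (2 * K + 1) * card ?M"
    unfolding card_cartesian_product by (rule mult_right_mono[OF card_W]) simp
  finally have "2 * (\<Sum>k<K. k) \<le> 2 * ((2 * K + 1) * card ?M)" by simp
  moreover have "2 * (\<Sum>k<K. k) + K = K * K"
    by (induction K) simp_all
  ultimately have "K * K \<le> 2 * ((2 * K + 1) * card ?M) + K" by linarith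
  then have "real (K * K) \<le> real (2 * ((2 * K + 1) * card ?M) + K)" by (rule of_nat_mono)
  then have 1: "real K * real K \<le> (4 * real K + 2) * real (card ?M) + real K"
    by (simp add: algebra_simps)
  have "(real K / 4 - 3 / 8) * (4 * real K + 2) \<le> real K * real K - real K"
    by (simp add: field_simps)
  also have "\<dots> \<le> real (card ?M) * (4 * real K + 2)" using 1 by (simp add: mult.commute)
  finally have 2: "real K / 4 - 3 / 8 \<le> real (card ?M)"
    by (rule mult_right_le_imp_le) simp
  have "24 * X + 1 \<le> (6 * real K + 5)\<^sup>2"
  proof -
    have "real (2 * pent K) = real (K * (3 * K + 1))" unfolding pent_double ..
    then have "24 * real (?b K) + 1 = (6 * real K + 5)\<^sup>2"
      by (simp add: power2_eq_square algebra_simps)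
    moreover have "24 * X + 1 \<le> 24 * real (?b K) + 1" using K by simp
    ultimately show ?thesis by (simp only:)
  qed
  then have "sqrt (24 * X + 1) \<le> 6 * real K + 5"
    by (intro real_le_lsqrt) simp_all
  then show ?thesis using 2 by (simp add: field_simps)
qed

text \<open>
  The recurrence vanishes also for \<open>g / 2\<close>, so \<open>even_witness\<close> yields an even value of
  \<open>g / 2\<close>.
\<close>
lemma half_even_witness:
  assumes "\<And>m. even (g m)" "pent_rec g n = 0" "pent k \<le> n" "n < pent k + 2 * k + 1"
  shows "\<exists>e\<in>pents. e \<le> n \<and> 4 dvd g (n - e)"
proof -
  define v where "v m = g m div 2" for m
  have g: "g = (\<lambda>m. 2 * v m)" using assms(1) by (simp add: v_def fun_eq_iff)
  have "even (pent_rec v n)" using assms(2) unfolding g pent_rec_double by simp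
  from even_witness[OF assms(3,4) this] obtain e where "e \<in> pents" "e \<le> n" "even (v (n - e))" by blast
  moreover have "4 dvd g (n - e)"
    using mult_dvd_mono[OF dvd_refl[of 2] \<open>even (v (n - e))\<close>] by (simp add: g)
  ultimately show ?thesis by blast
qed

lemma E_eq: "E f 0 a X = card {n. real n < X \<and> a dvd f n}"
  by (simp add: E_def cong_0_iff)

text \<open>
  A block has \<open>2 k\<close> elements besides its left end, and the left end is the only pentagonal number in
  it.
\<close>
lemma ce_bound:
  assumes "X \<ge> 0"
  shows "(sqrt (24 * X + 1) - 14) / 24 \<le> real (E (\<lambda>n. int (ce n)) 0 4 X)"
  unfolding E_eq
proof (rule count_bound[where B = "- pents"])
  fix k
  have "{pent k<..<pent k + 2 * k + 1} \<subseteq> {n \<in> - pents. pent k \<le> n \<and> n < pent k + 2 * k + 1}"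
  proof
    fix n assume n: "n \<in> {pent k<..<pent k + 2 * k + 1}"
    have "n \<noteq> pent j \<and> n \<noteq> pent j + 2 * j + 1" for j
      using n pent_less[of j k] pent_less[of k j] by (cases j k rule: linorder_cases) auto
    then show "n \<in> {n \<in> - pents. pent k \<le> n \<and> n < pent k + 2 * k + 1}"
      using n by (auto simp: pents_def)
  qed
  then have "card {pent k<..<pent k + 2 * k + 1} \<le> card {n \<in> - pents. pent k \<le> n \<and> n < pent k + 2 * k + 1}"
    by (intro card_mono) simp_all
  then show "k \<le> card {n \<in> - pents. pent k \<le> n \<and> n < pent k + 2 * k + 1}" by simp
next
  fix n k assume n: "n \<in> - pents" "pent k \<le> n" "n < pent k + 2 * k + 1"
  obtain e where e: "e \<in> pents" "e \<le> n" "4 dvd int (ce (n - e)) - (if n - e = 0 then 1 else 0)"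
    using half_even_witness[OF ce_even ce_vanishing n(2,3)] n(1) by auto
  \<comment> \<open>\<open>n\<close> is not pentagonal, so the witness avoids the index \<open>0\<close>, where \<open>ce\<close> is odd\<close>
  then have "n - e \<noteq> 0" using n(1) by (metis ComplD diff_is_0_eq le_antisym)
  then show "\<exists>e\<in>pents. e \<le> n \<and> 4 dvd int (ce (n - e))" using e by auto
qed (rule assms)

lemma co1_bound:
  assumes "X \<ge> 0"
  shows "(sqrt (24 * X + 1) - 14) / 24 \<le> real (E co1' 0 4 X)"
  unfolding E_eq
proof (rule count_bound[where B = "{n. n mod 2 = 1}"])
  show "k \<le> card {n \<in> {n. n mod 2 = 1}. pent k \<le> n \<and> n < pent k + 2 * k + 1}" for k
    using parity_class_card[of 1 k "pent k"] by simp
  show "\<exists>e\<in>pents. e \<le> n \<and> 4 dvd co1' (n - e)"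
    if "n \<in> {n. n mod 2 = 1}" "pent k \<le> n" "n < pent k + 2 * k + 1" for n k
    by (rule half_even_witness[OF co1_even co1_vanishing that(2,3)])
      (use that(1) in \<open>simp add: odd_iff_mod_2_eq_one\<close>)
qed (rule assms)

text \<open>
  The integer \<open>0\<close> has to be left out, because \<open>(q)\<^sub>\<infinity> \<Sum> co2(n)
  q\<^sup>n\<close> has constant term \<open>1\<close>; it is the only element of the block \<open>k = 0\<close>,
  where the condition of \<open>count_bound\<close> is trivial.
\<close>
lemma co2_bound:
  assumes "X \<ge> 0"
  shows "(sqrt (24 * X + 1) - 14) / 24 \<le> real (E (\<lambda>n. int (co2 n)) 0 2 X)"
  unfolding E_eq
proof (rule count_bound[where B = "{n. n mod 2 = 0 \<and> n > 0}"])
  fix k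
  show "k \<le> card {n \<in> {n. n mod 2 = 0 \<and> n > 0}. pent k \<le> n \<and> n < pent k + 2 * k + 1}"
  proof (cases "k = 0")
    case False
    then have "pent k > 0" using le_pent[of k] by linarith
    then have "{n \<in> {n. n mod 2 = 0 \<and> n > 0}. pent k \<le> n \<and> n < pent k + 2 * k + 1}
        = {n. n mod 2 = 0 \<and> pent k \<le> n \<and> n < pent k + 2 * k + 1}" by auto
    then show ?thesis using parity_class_card[of 0 k "pent k"] by simp
  qed simp
next
  fix n k assume "n \<in> {n. n mod 2 = 0 \<and> n > 0}" "pent k \<le> n" "n < pent k + 2 * k + 1"
  then show "\<exists>e\<in>pents. e \<le> n \<and> 2 dvd int (co2 (n - e))"
    by (intro even_witness[where u = "\<lambda>n. int (co2 n)"]) (auto simp: co2_vanishing)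
qed (rule assms)

text \<open>
  As \<open>\<surd>(24 X + 1) \<ge> 4 \<surd>X\<close>, the right-hand side is at least \<open>\<surd>X / 6 - 14 /
  24\<close>, and \<open>1 / 6 - 1 / 8 = 1 / 24\<close> compensates for \<open>14 / 24\<close> once
  \<open>\<surd>X > 14\<close>.
\<close>
lemma sqrt_bound:
  fixes X :: real
  assumes "X > 196"
  shows "1 / 8 * sqrt X < (sqrt (24 * X + 1) - 14) / 24"
proof -
  have "14 < sqrt X" by (rule real_less_rsqrt) (use assms in simp)
  moreover have "4 * sqrt X \<le> sqrt (24 * X + 1)"
    by (rule real_le_rsqrt) (use assms in \<open>simp add: power_mult_distrib\<close>)
  ultimately show ?thesis by simp
qed

text \<open>
  With \<open>y = \<surd>(24 X + 1)\<close> we have \<open>24 X = (y - 1) (y + 1)\<close>, so the left-hand side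
  is \<open>(y - 1) / 24 - (y - 1) / (24 L)\<close>. It lies below \<open>(y - 14) / 24\<close> as soon as
  \<open>(y - 1) / L\<close> exceeds \<open>13 = 14 - 1\<close>.
\<close>
lemma log_bound:
  fixes X L :: real
  assumes "X \<ge> 0" "L > 0" "13 * L < sqrt (24 * X + 1) - 1"
  shows "(X * L - 1 * X) / ((sqrt (24 * X + 1) + 1) * L) < (sqrt (24 * X + 1) - 14) / 24"
proof -
  define y where "y = sqrt (24 * X + 1)"
  have "y * y = 24 * X + 1" using assms(1) by (simp add: y_def)
  then have X: "X = (y - 1) * (y + 1) / 24" by (simp add: algebra_simps)
  have "y + 1 > 0" using assms(2,3) by (simp add: y_def)
  then have "(X * L - 1 * X) / ((y + 1) * L) = (y - 1) * (L - 1) / (24 * L)"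
    using assms(2) unfolding X by (simp add: divide_simps) (simp add: algebra_simps)
  also have "\<dots> < (y - 14) / 24"
  proof -
    have "13 * L < y - 1" using assms(3) unfolding y_def .
    then show ?thesis using assms(2) by (simp add: field_simps)
  qed
  finally show ?thesis unfolding y_def .
qed

theorem theorem1p1:
  "(\<exists>c::real. c > 0 \<and>
      (\<forall>\<^sub>F X::real in at_top. real (E (\<lambda>n. int (ce n)) 0 4 X) > c * sqrt X)) \<and>
   (\<exists>c \<alpha>::real. c > 0 \<and> 0 < \<alpha> \<and> \<alpha> < 1 \<and>
      (\<forall>\<^sub>F X::real in at_top. real (E co1' 0 4 X) >
         (X * (ln X powr \<alpha>) - c * X) / ((sqrt (24 * X + 1) + 1) * (ln X powr \<alpha>)))) \<and>
   (\<exists>c::real. c > 0 \<and>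
      (\<forall>\<^sub>F X::real in at_top. real (E (\<lambda>n. int (co2 n)) 0 2 X) > c * sqrt X))"
proof (intro conjI)
  have "\<forall>\<^sub>F X::real in at_top. real (E (\<lambda>n. int (ce n)) 0 4 X) > 1 / 8 * sqrt X"
    using eventually_gt_at_top[of 196]
    by eventually_elim (rule less_le_trans[OF sqrt_bound ce_bound], simp_all)
  then show "\<exists>c::real. c > 0 \<and>
      (\<forall>\<^sub>F X::real in at_top. real (E (\<lambda>n. int (ce n)) 0 4 X) > c * sqrt X)"
    by (intro exI[of _ "1 / 8"]) simp
  have "\<forall>\<^sub>F X::real in at_top. real (E (\<lambda>n. int (co2 n)) 0 2 X) > 1 / 8 * sqrt X"
    using eventually_gt_at_top[of 196]
    by eventually_elim (rule less_le_trans[OF sqrt_bound co2_bound], simp_all)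
  then show "\<exists>c::real. c > 0 \<and>
      (\<forall>\<^sub>F X::real in at_top. real (E (\<lambda>n. int (co2 n)) 0 2 X) > c * sqrt X)"
    by (intro exI[of _ "1 / 8"]) simp
  \<comment> \<open>the choice \<open>c = 1\<close> and \<open>\<alpha> = 1 / 2\<close> is arbitrary: \<open>\<surd>X\<close> outgrows every power of \<open>ln X\<close>\<close>
  have "\<forall>\<^sub>F X::real in at_top. 13 * ln X powr (1/2) < sqrt (24 * X + 1) - 1"
    by real_asymp
  with eventually_gt_at_top[of 1]
  have "\<forall>\<^sub>F X::real in at_top. real (E co1' 0 4 X)
      > (X * (ln X powr (1/2)) - 1 * X) / ((sqrt (24 * X + 1) + 1) * (ln X powr (1/2)))"
    by eventually_elim (rule less_le_trans[OF log_bound co1_bound], simp_all)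
  then show "\<exists>c \<alpha>::real. c > 0 \<and> 0 < \<alpha> \<and> \<alpha> < 1 \<and>
      (\<forall>\<^sub>F X::real in at_top. real (E co1' 0 4 X) >
         (X * (ln X powr \<alpha>) - c * X) / ((sqrt (24 * X + 1) + 1) * (ln X powr \<alpha>)))"
    by (intro exI[of _ 1] exI[of _ "1 / 2"]) simp
qed

end
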